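(* For every irreducible Markov chain $(\Omega,P,\pi)$ on a finite state space, $$\kappa\le t_{\mathrm{LS}}\le 2\big(\kappa+t_{\mathrm{rel}}(1+\log 49)\big)\le 2\big(1+(1+\log 49)/\log 2\big)\kappa<17\,\kappa .$$
   Context: Setting: $P$ is an irreducible (not necessarily reversible) transition matrix on a finite set $\Omega$ (with $|\Omega|\ge2$ implicit), with stationary distribution $\pi$. $P^*(x,y)=\pi(y)P(y,x)/\pi(x)$ and $Q=(P+P^* )/2$. The spectral gap $\lambda$ is the smallest non-zero eigenvalue of $I-Q$, and $t_{\mathrm{rel}}=1/\lambda$. For nonempty $A\subsetneq\Omega$, $Q_A$ is the restriction of $Q$ to $A$ (a substochastic matrix indexed by $A$), and $\lambda(A)$ is the smallest eigenvalue of $I-Q_A$. Let $(X_t)_{t\ge0}$ be the continuous-time chain with heat kernel $e^{-t(I-P)}$, $T_A=\inf\{t\ge 0:X_t\in A\}$, $T_b=T_{\{b\}}$. A nonempty $A\subset\Omega$ is connected if $\mathrm P_a[T_b<T_{A^c}]>0$ for all $a,b\in A$; $\mathrm{Con}_{1/2}$ is the collection of connected sets with $\pi(A)\le1/2$. Define $$\alpha(A)=\frac{\lambda(A)}{|\log\pi(A)|},\qquad \alpha=\min_{A\in\mathrm{Con}_{1/2}}\alpha(A),\qquad \kappa=1/\alpha .$$ Log-Sobolev time: $t_{\mathrm{LS}}=1/c_{\mathrm{LS}}$, where $c_{\mathrm{LS}}=\inf\{\mathcal E(f)/\mathrm{Ent}_\pi(f^2): f\in\mathbb R^\Omega\text{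 non-constant}\}$ (ratio read as $+\infty$ if the denominator is $0$), $\mathcal E(f)=\sum_x\pi(x)f(x)\,((I-Q)f)(x)$, and $\mathrm{Ent}_\pi(g)=\mathbb E_\pi[g\log g]-\mathbb E_\pi[g]\log\mathbb E_\pi[g]$ for $g\ge0$ (with $0\log0=0$).
   Formalization: Connectedness of A (hence Con_{1/2}, α, κ) is taken for the chain with kernel e^{-t(I-Q)}, Q=(P+P* )/2, instead of e^{-t(I-P)}; the two agree for reversible P. With P the third inequality fails on the directed 8-cycle: κ=log 8, but t_rel≈3.41 > κ/log 2=3. *)

theory Defs
  imports "HOL-Probability.Probability"
begin

definition transition_matrix :: "real^'a^'a \<Rightarrow> bool" where
  "transition_matrix P \<longleftrightarrow> (\<forall>x y. 0 \<le> P $ x $ y) \<and> (\<forall>x. (\<Sum>y\<in>UNIV. P $ x $ y) = 1)"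

definition matrix_power :: "real^'a^'a \<Rightarrow> nat \<Rightarrow> real^'a^'a" where
  "matrix_power M n = (((**) M) ^^ n) (mat 1)"

definition irreducible_matrix :: "real^'a^'a \<Rightarrow> bool" where
  "irreducible_matrix P \<longleftrightarrow> (\<forall>x y. \<exists>n. 0 < matrix_power P n $ x $ y)"

definition stationary_distribution :: "real^'a^'a \<Rightarrow> real^'a \<Rightarrow> bool" where
  "stationary_distribution P \<pi> \<longleftrightarrow>
     (\<forall>x. 0 \<le> \<pi> $ x) \<and> (\<Sum>x\<in>UNIV. \<pi> $ x) = 1 \<and> \<pi> v* P = \<pi>"

definition time_reversal :: "real^'a^'a \<Rightarrow> real^'a \<Rightarrow> real^'a^'a" where
  "time_reversal P \<pi> = (\<chi> x y. \<pi> $ y * P $ y $ x / \<pi> $ x)"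

definition symmetrization :: "real^'a^'a \<Rightarrow> real^'a \<Rightarrow> real^'a^'a" where
  "symmetrization P \<pi> = (1 / 2) *\<^sub>R (P + time_reversal P \<pi>)"

text \<open>The eigenvalues of the principal submatrix of \<open>M\<close> with rows and columns in \<open>A\<close>;
  only the values of the eigenvector \<open>f\<close> on \<open>A\<close> matter.\<close>

definition eigenvalue_on :: "'a set \<Rightarrow> real^'a^'a \<Rightarrow> real \<Rightarrow> bool" where
  "eigenvalue_on A M \<mu> \<longleftrightarrow>
     (\<exists>f :: real^'a. (\<exists>x\<in>A. f $ x \<noteq> 0) \<and> (\<forall>x\<in>A. (\<Sum>y\<in>A. M $ x $ y * f $ y) = \<mu> * f $ x))"

definition spectral_gap :: "real^'a^'a \<Rightarrow> real^'a \<Rightarrow> real" where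
  "spectral_gap P \<pi> = (LEAST \<mu>. \<mu> \<noteq> 0 \<and> eigenvalue_on UNIV (mat 1 - symmetrization P \<pi>) \<mu>)"

definition t_rel :: "real^'a^'a \<Rightarrow> real^'a \<Rightarrow> real" where
  "t_rel P \<pi> = 1 / spectral_gap P \<pi>"

definition lambda_set :: "real^'a^'a \<Rightarrow> real^'a \<Rightarrow> 'a set \<Rightarrow> real" where
  "lambda_set P \<pi> A = (LEAST \<mu>. eigenvalue_on A (mat 1 - symmetrization P \<pi>) \<mu>)"

definition heat_kernel :: "real^'a^'a \<Rightarrow> real \<Rightarrow> real^'a^'a" where
  "heat_kernel P t = (\<Sum>k. ((- t) ^ k / fact k) *\<^sub>R matrix_power (mat 1 - P) k)"

text \<open>
  A construction of the continuous-time chain with heat kernel \<open>heat_kernel P\<close>, for all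
  starting points on one probability space.  A sample point is a pair \<open>(e, F)\<close>: the \<open>e n\<close>
  are independent exponential holding times of rate 1, the \<open>F (n, x)\<close> are independent
  with law \<open>P $ x\<close>, and the \<open>n\<close>-th jump leads from \<open>x\<close> to \<open>F (n, x)\<close> (possibly \<open>x\<close> itself).
  The number of jumps up to time \<open>t\<close> is the least \<open>n\<close> with \<open>t < e 0 + \<dots> + e n\<close>.
  Every path is right-continuous, also on the null set where some \<open>e n\<close> is not positive
  or the sum of the \<open>e n\<close> converges.  The law at time \<open>t\<close> is given by \<open>ctmc_heat_kernel\<close> below.\<close>

definition step_pmf :: "real^'a^'a \<Rightarrow> 'a \<Rightarrow> 'a pmf" where
  "step_pmf P x = embed_pmf (\<lambda>y. P $ x $ y)"

definition ctmc_space :: "real^'a^'a \<Rightarrow> ((nat \<Rightarrow> real) \<times> (nat \<times> 'a \<Rightarrow> 'a)) measure" where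
  "ctmc_space P =
     (\<Pi>\<^sub>M n\<in>UNIV. density lborel (exponential_density 1)) \<Otimes>\<^sub>M
     (\<Pi>\<^sub>M i\<in>UNIV. measure_pmf (step_pmf P (snd i)))"

primrec jump_chain :: "'a \<Rightarrow> (nat \<times> 'a \<Rightarrow> 'a) \<Rightarrow> nat \<Rightarrow> 'a" where
  "jump_chain a F 0 = a"
| "jump_chain a F (Suc n) = F (n, jump_chain a F n)"

definition ctmc :: "'a \<Rightarrow> real \<Rightarrow> (nat \<Rightarrow> real) \<times> (nat \<times> 'a \<Rightarrow> 'a) \<Rightarrow> 'a" where
  "ctmc a t = (\<lambda>(e, F). jump_chain a F (LEAST n. t < (\<Sum>i\<le>n. e i)))"

definition hitting_time :: "(real \<Rightarrow> 'w \<Rightarrow> 'a) \<Rightarrow> 'a set \<Rightarrow> 'w \<Rightarrow> ereal" where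
  "hitting_time X A \<omega> = Inf {ereal t | t. 0 \<le> t \<and> X t \<omega> \<in> A}"

lemma pmf_step_pmf:
  assumes "transition_matrix P"
  shows "pmf (step_pmf P x) y = P $ x $ y"
  unfolding step_pmf_def
proof (rule pmf_embed_pmf)
  show "0 \<le> P $ x $ z" for z using assms by (auto simp: transition_matrix_def)
  then have "(\<integral>\<^sup>+ z. ennreal (P $ x $ z) \<partial>count_space UNIV) = ennreal (\<Sum>z\<in>UNIV. P $ x $ z)"
    by (simp add: nn_integral_count_space_finite sum_ennreal)
  then show "(\<integral>\<^sup>+ z. ennreal (P $ x $ z) \<partial>count_space UNIV) = 1"
    using assms by (simp add: transition_matrix_def)
qed

lemma matrix_power_0: "matrix_power M 0 = mat 1"
  and matrix_power_Suc: "matrix_power M (Suc n) = M ** matrix_power M n"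
  by (simp_all add: matrix_power_def)

lemma matrix_power_Suc_right: "matrix_power M (Suc n) = matrix_power M n ** M"
proof (induction n)
  case 0
  then show ?case by (simp add: matrix_power_0 matrix_power_Suc)
next
  case (Suc n)
  have "matrix_power M (Suc (Suc n)) = M ** matrix_power M (Suc n)"
    by (rule matrix_power_Suc)
  also have "\<dots> = (M ** matrix_power M n) ** M"
    using Suc by (simp add: matrix_mul_assoc)
  finally show ?case by (simp only: matrix_power_Suc)
qed

abbreviation "jump_space P \<equiv> (\<Pi>\<^sub>M i\<in>UNIV. measure_pmf (step_pmf P (snd i)))"

lemma space_jump_space: "space (jump_space P) = UNIV"
  by (simp add: space_PiM)

lemma measurable_jump [measurable]: "(\<lambda>F. F i) \<in> jump_space P \<rightarrow>\<^sub>M count_space UNIV"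
proof -
  have "(\<lambda>F. F i) \<in> jump_space P \<rightarrow>\<^sub>M measure_pmf (step_pmf P (snd i))"
    by (rule measurable_component_singleton) simp
  then show ?thesis by simp
qed

lemma measurable_jump_chain [measurable]:
  "(\<lambda>F. jump_chain a F n) \<in> jump_space P \<rightarrow>\<^sub>M count_space (UNIV::'a::finite set)"
proof (induction n)
  case (Suc n)
  have "(\<lambda>F. (\<lambda>z F. F (n, z)) (jump_chain a F n) F) \<in> jump_space P \<rightarrow>\<^sub>M count_space UNIV"
  proof (rule measurable_compose_countable[OF _ Suc])
    show "(\<lambda>F. F (n, i)) \<in> jump_space P \<rightarrow>\<^sub>M count_space UNIV" for i
      by (rule measurable_jump)
  qed
  then show ?case by simp
qed simp

lemma jump_law_aux:
  assumes P: "transition_matrix P" and "finite J" "\<And>i. i \<in> J \<Longrightarrow> n \<le> fst i"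
  shows "measure (jump_space P) {F. jump_chain a F n = y \<and> (\<forall>i\<in>J. F i = g i)}
     = matrix_power P n $ a $ y * (\<Prod>i\<in>J. P $ snd i $ g i)"
  using assms(2,3)
proof (induction n arbitrary: y J g)
  case 0
  interpret J: product_prob_space "\<lambda>i. measure_pmf (step_pmf P (snd i))" UNIV
    by unfold_locales
  have "measure (jump_space P) {F. \<forall>i\<in>J. F i = g i} =
        measure (jump_space P) (prod_emb UNIV (\<lambda>i. measure_pmf (step_pmf P (snd i))) J (\<Pi>\<^sub>E i\<in>J. {g i}))"
    by (rule arg_cong[where f="measure _"]) (auto simp: prod_emb_def PiE_iff)
  also have "\<dots> = (\<Prod>i\<in>J. measure (measure_pmf (step_pmf P (snd i))) {g i})"
    using 0 by (intro J.measure_PiM_emb) auto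
  also have "\<dots> = (\<Prod>i\<in>J. P $ snd i $ g i)"
    by (simp add: measure_pmf_single pmf_step_pmf[OF P])
  finally show ?case
    by (auto simp: matrix_power_0 mat_def)
next
  case (Suc n)
  interpret J: product_prob_space "\<lambda>i. measure_pmf (step_pmf P (snd i))" UNIV
    by unfold_locales
  let ?E = "\<lambda>z. {F. jump_chain a F n = z \<and> (\<forall>i\<in>insert (n, z) J. F i = (g((n, z) := y)) i)}"
  have nJ: "(n, z) \<notin> J" for z using Suc.prems(2) by force
  have "?E z \<in> sets (jump_space P)" for z
  proof -
    have "{F \<in> space (jump_space P). jump_chain a F n = z \<and> (\<forall>i\<in>insert (n, z) J. F i = (g((n, z) := y)) i)} \<in> sets (jump_space P)"
      using Suc.prems(1) by measurable
    then show ?thesis by (simp add: space_jump_space)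
  qed
  then have m: "range ?E \<subseteq> sets (jump_space P)" by blast
  have "{F. jump_chain a F (Suc n) = y \<and> (\<forall>i\<in>J. F i = g i)} = (\<Union>z. ?E z)"
    using nJ by (auto split: if_splits)
  also have "measure (jump_space P) \<dots> = (\<Sum>z\<in>UNIV. measure (jump_space P) (?E z))"
    using m by (intro J.finite_measure_finite_Union) (auto simp: disjoint_family_on_def)
  also have "\<dots> = (\<Sum>z\<in>UNIV. matrix_power P n $ a $ z * (\<Prod>i\<in>insert (n, z) J. P $ snd i $ (g((n, z) := y)) i))"
    using Suc.prems by (intro sum.cong refl Suc.IH) force+
  also have "\<dots> = (\<Sum>z\<in>UNIV. matrix_power P n $ a $ z * (P $ z $ y * (\<Prod>i\<in>J. P $ snd i $ g i)))"
    using Suc.prems(1) nJ by (intro sum.cong refl arg_cong2[where f="(*)"])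
       (auto intro!: prod.cong)
  finally show ?case
    by (simp add: matrix_power_Suc_right matrix_matrix_mult_def sum_distrib_right mult.assoc)
qed

lemma jump_law:
  assumes P: "transition_matrix P"
  shows "measure (jump_space P) {F. jump_chain a F n = y} = matrix_power P n $ a $ y"
  using jump_law_aux[OF P, of "{}" n a y] by simp


abbreviation "hold_space \<equiv> (\<Pi>\<^sub>M n\<in>(UNIV::nat set). density lborel (exponential_density 1))"

lemma prob_space_hold: "prob_space hold_space"
  by (intro prob_space_PiM prob_space_exponential_density) simp

lemma space_hold_space: "space hold_space = UNIV"
  by (simp add: space_PiM)

lemma measurable_hold [measurable]: "(\<lambda>e. e i) \<in> borel_measurable hold_space"
proof -
  have "(\<lambda>e. e i) \<in> hold_space \<rightarrow>\<^sub>M density lborel (exponential_density 1)"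
    by (rule measurable_component_singleton) simp
  then show ?thesis by simp
qed

lemma distr_hold:
  assumes "sets N = sets borel"
  shows "distr hold_space N (\<lambda>e. e i) = density lborel (exponential_density 1)"
proof -
  have "distr hold_space N (\<lambda>e. e i) =
        distr hold_space (density lborel (exponential_density 1)) (\<lambda>e. e i)"
    using assms by (intro distr_cong) auto
  also have "\<dots> = density lborel (exponential_density 1)"
    by (rule distr_PiM_component[where M="\<lambda>_. density lborel (exponential_density 1)"])
       (simp_all add: prob_space_exponential_density)
  finally show ?thesis .
qed

lemma hold_tail:
  assumes "0 \<le> t"
  shows "measure hold_space {e. t < (\<Sum>i\<le>n. e i)} = (\<Sum>k\<le>n. t ^ k / fact k * exp (- t))"
proof -
  interpret prob_space hold_space by (rule prob_space_hold)
  have D: "distributed hold_space lborel (\<lambda>e. e i) (exponential_density 1)" for i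
    unfolding distributed_def by (auto simp: distr_hold)
  have "indep_vars (\<lambda>_. borel) (\<lambda>i e. e i) (UNIV :: nat set)"
  proof (subst indep_vars_iff_distr_eq_PiM)
    have "distr hold_space (PiM UNIV (\<lambda>i. borel)) (\<lambda>x. \<lambda>i\<in>UNIV. x i) = distr hold_space hold_space (\<lambda>x. x)"
      by (intro distr_cong sets_PiM_cong) auto
    also have "\<dots> = hold_space" by simp
    also have "\<dots> = (\<Pi>\<^sub>M i\<in>UNIV. distr hold_space borel (\<lambda>e. e i))"
      by (simp add: distr_hold)
    finally show "distr hold_space (PiM UNIV (\<lambda>i. borel)) (\<lambda>x. \<lambda>i\<in>UNIV. x i)
      = (\<Pi>\<^sub>M i\<in>UNIV. distr hold_space borel (\<lambda>e. e i))" .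
  qed auto
  then have "indep_vars (\<lambda>_. borel) (\<lambda>i e. e i) {..n}"
    by (rule indep_vars_subset) simp
  with D have S: "distributed hold_space lborel (\<lambda>e. \<Sum>i\<le>n. e i) (erlang_density n 1)"
    using exponential_distributed_sum[of "{..n}" 1 "\<lambda>i e. e i"] by auto
  have "\<P>(e in hold_space. t < (\<Sum>i\<le>n. e i)) = 1 - erlang_CDF n 1 t"
    using assms by (intro erlang_distributed_gt[OF S]) auto
  then show ?thesis
    using assms by (simp add: erlang_CDF_def space_hold_space sum_distrib_right)
qed

lemma AE_hold: "AE e in hold_space. \<forall>i. 0 \<le> e i"
  unfolding AE_all_countable
proof
  fix i
  have "AE x in density lborel (exponential_density 1). (0::real) \<le> x"
    by (subst AE_density) (auto simp: exponential_density_def)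
  then show "AE e in hold_space. 0 \<le> e i"
    by (intro AE_PiM_component[where M="\<lambda>_. density lborel (exponential_density 1)"])
       (auto simp: prob_space_exponential_density)
qed

definition "jumps_at t n = {e :: nat \<Rightarrow> real. t < (\<Sum>i\<le>n. e i) \<and> (\<forall>m<n. (\<Sum>i\<le>m. e i) \<le> t)}"

lemma sets_jumps_at [measurable]: "jumps_at t n \<in> sets hold_space"
proof -
  have "{e \<in> space hold_space. t < (\<Sum>i\<le>n. e i) \<and> (\<forall>m<n. (\<Sum>i\<le>m. e i) \<le> t)} \<in> sets hold_space"
    by measurable
  then show ?thesis by (simp add: jumps_at_def space_hold_space)
qed

lemma jumps_at_law:
  assumes "0 \<le> t"
  shows "measure hold_space (jumps_at t n) = t ^ n / fact n * exp (- t)"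
proof -
  interpret prob_space hold_space by (rule prob_space_hold)
  have m [measurable]: "{e. t < (\<Sum>i\<le>n. e i)} \<in> sets hold_space" for n
  proof -
    have "{e \<in> space hold_space. t < (\<Sum>i\<le>n. e i)} \<in> sets hold_space" by measurable
    then show ?thesis by (simp add: space_hold_space)
  qed
  show ?thesis
  proof (cases n)
    case 0
    then show ?thesis using hold_tail[OF assms, of 0] by (simp add: jumps_at_def)
  next
    case (Suc k)
    have "measure hold_space (jumps_at t n)
        = measure hold_space ({e. t < (\<Sum>i\<le>Suc k. e i)} - {e. t < (\<Sum>i\<le>k. e i)})"
    proof (rule finite_measure_eq_AE)
      show "AE e in hold_space. (e \<in> jumps_at t n) =
          (e \<in> {e. t < (\<Sum>i\<le>Suc k. e i)} - {e. t < (\<Sum>i\<le>k. e i)})"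
        using AE_hold
      proof eventually_elim
        case (elim e)
        have "(\<Sum>i\<le>m. e i) \<le> (\<Sum>i\<le>k. e i)" if "m \<le> k" for m
          using elim that by (intro sum_mono2) auto
        then show ?case
          unfolding jumps_at_def Suc by (fastforce simp: less_Suc_eq_le)
      qed
    qed (use sets.Diff[OF m[of "Suc k"] m[of k]] in auto)
    also have "\<dots> = measure hold_space {e. t < (\<Sum>i\<le>Suc k. e i)} -
        measure hold_space ({e. t < (\<Sum>i\<le>Suc k. e i)} \<inter> {e. t < (\<Sum>i\<le>k. e i)})"
      by (rule finite_measure_Diff'[OF m m])
    also have "measure hold_space ({e. t < (\<Sum>i\<le>Suc k. e i)} \<inter> {e. t < (\<Sum>i\<le>k. e i)})
        = measure hold_space {e. t < (\<Sum>i\<le>k. e i)}"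
    proof (rule finite_measure_eq_AE)
      show "AE e in hold_space. (e \<in> {e. t < (\<Sum>i\<le>Suc k. e i)} \<inter> {e. t < (\<Sum>i\<le>k. e i)}) =
          (e \<in> {e. t < (\<Sum>i\<le>k. e i)})"
        using AE_hold
      proof eventually_elim
        case (elim e)
        then have "0 \<le> e (Suc k)" by blast
        then show ?case by auto
      qed
    qed (use m[of k] m[of "Suc k"] sets.Int[OF m[of "Suc k"] m[of k]] in auto)
    finally show ?thesis
      unfolding hold_tail[OF assms] Suc by simp
  qed
qed

lemma AE_jumps_at:
  assumes "0 \<le> t"
  shows "AE e in hold_space. \<exists>n. e \<in> jumps_at t n"
proof -
  interpret prob_space hold_space by (rule prob_space_hold)
  have d: "disjoint_family (jumps_at t)"
    unfolding disjoint_family_on_def jumps_at_def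
    by (auto simp: set_eq_iff) (metis linorder_neqE_nat not_le)
  have "(\<lambda>n. measure hold_space (jumps_at t n)) sums measure hold_space (\<Union>n. jumps_at t n)"
    using d by (intro finite_measure_UNION) auto
  moreover have "(\<lambda>n. t ^ n / fact n * exp (- t)) sums (exp t * exp (- t))"
    using exp_converges[of t] by (intro sums_mult2) (simp add: field_simps)
  ultimately have "measure hold_space (\<Union>n. jumps_at t n) = 1"
    by (simp add: jumps_at_law[OF assms] sums_unique2 exp_minus)
  then show ?thesis
    using AE_prob_1[of "\<Union>n. jumps_at t n"] by simp
qed

lemma measurable_ctmc [measurable]: "ctmc a t \<in> ctmc_space P \<rightarrow>\<^sub>M count_space UNIV"
proof -
  have "(\<lambda>\<omega>. (\<lambda>n \<omega>. jump_chain a (snd \<omega>) n) (LEAST n. t < (\<Sum>i\<le>n. fst \<omega> i)) \<omega>)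
      \<in> ctmc_space P \<rightarrow>\<^sub>M count_space UNIV"
    unfolding ctmc_space_def by (rule measurable_compose_countable) measurable
  then show ?thesis by (simp add: ctmc_def case_prod_unfold)
qed

lemma ctmc_law:
  assumes P: "transition_matrix P" and t: "0 \<le> t"
  shows "(\<lambda>n. t ^ n / fact n * exp (- t) * matrix_power P n $ a $ y) sums
     measure (ctmc_space P) {\<omega> \<in> space (ctmc_space P). ctmc a t \<omega> = y}"
proof -
  interpret H: prob_space hold_space by (rule prob_space_hold)
  interpret J: prob_space "jump_space P" by (intro prob_space_PiM) (simp add: measure_pmf.prob_space_axioms)
  interpret HJ: pair_prob_space hold_space "jump_space P" ..
  have C: "ctmc_space P = hold_space \<Otimes>\<^sub>M jump_space P" by (simp add: ctmc_space_def)
  let ?B = "\<lambda>n. jumps_at t n \<times> {F. jump_chain a F n = y}"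
  have jm: "{F. jump_chain a F n = y} \<in> sets (jump_space P)" for n
  proof -
    have "{F \<in> space (jump_space P). jump_chain a F n = y} \<in> sets (jump_space P)" by measurable
    then show ?thesis by (simp add: space_jump_space)
  qed
  have Bm: "?B n \<in> sets (ctmc_space P)" for n
    unfolding C using jm by (intro pair_measureI) auto
  have Xm: "{\<omega> \<in> space (ctmc_space P). ctmc a t \<omega> = y} \<in> sets (ctmc_space P)"
  proof -
    show ?thesis by measurable
  qed
  have d: "disjoint_family ?B"
    unfolding disjoint_family_on_def jumps_at_def
    by (auto simp: set_eq_iff) (metis linorder_neqE_nat not_le)
  have "(\<lambda>n. measure (ctmc_space P) (?B n)) sums measure (ctmc_space P) (\<Union>n. ?B n)"
    using d Bm unfolding C by (intro HJ.P.finite_measure_UNION) auto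
  also have "(\<lambda>n. measure (ctmc_space P) (?B n)) = (\<lambda>n. t ^ n / fact n * exp (- t) * matrix_power P n $ a $ y)"
  proof
    fix n
    have "measure (ctmc_space P) (?B n) = measure hold_space (jumps_at t n) * measure (jump_space P) {F. jump_chain a F n = y}"
      by (simp add: C measure_def jm enn2real_mult J.emeasure_pair_measure_Times)
    then show "measure (ctmc_space P) (?B n) = t ^ n / fact n * exp (- t) * matrix_power P n $ a $ y"
      by (simp only: jumps_at_law[OF t] jump_law[OF P])
  qed
  also have "measure (ctmc_space P) (\<Union>n. ?B n) = measure (ctmc_space P) {\<omega> \<in> space (ctmc_space P). ctmc a t \<omega> = y}"
  proof (unfold C, rule HJ.P.finite_measure_eq_AE)
    have "AE \<omega> in hold_space \<Otimes>\<^sub>M jump_space P. \<exists>n. fst \<omega> \<in> jumps_at t n"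
    proof (rule AE_distrD[OF measurable_fst])
      show "AE e in distr (hold_space \<Otimes>\<^sub>M jump_space P) hold_space fst. \<exists>n. e \<in> jumps_at t n"
        using AE_jumps_at[OF t] by (simp only: J.distr_pair_fst)
    qed
    then show "AE \<omega> in hold_space \<Otimes>\<^sub>M jump_space P. (\<omega> \<in> (\<Union>n. ?B n)) =
       (\<omega> \<in> {\<omega> \<in> space (hold_space \<Otimes>\<^sub>M jump_space P). ctmc a t \<omega> = y})"
    proof eventually_elim
      case (elim \<omega>)
      then obtain n where n: "fst \<omega> \<in> jumps_at t n" by blast
      have L: "(LEAST n. t < (\<Sum>i\<le>n. fst \<omega> i)) = m" if "fst \<omega> \<in> jumps_at t m" for m
        using that unfolding jumps_at_def
        by (intro Least_equality) (auto simp: not_less[symmetric])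
      have "\<omega> \<in> (\<Union>n. ?B n) \<longleftrightarrow> jump_chain a (snd \<omega>) n = y"
      proof
        assume "\<omega> \<in> (\<Union>n. ?B n)"
        then obtain m where "fst \<omega> \<in> jumps_at t m" "jump_chain a (snd \<omega>) m = y"
          by (auto simp: mem_Times_iff)
        with L[of m] L[OF n] show "jump_chain a (snd \<omega>) n = y" by metis
      next
        assume "jump_chain a (snd \<omega>) n = y"
        with n have "\<omega> \<in> ?B n" by (simp add: mem_Times_iff)
        then show "\<omega> \<in> (\<Union>n. ?B n)" by blast
      qed
      moreover have "ctmc a t \<omega> = jump_chain a (snd \<omega>) n"
        using L[OF n] by (simp add: ctmc_def case_prod_unfold)
      ultimately show ?case
        by (simp add: space_pair_measure space_hold_space space_jump_space)
    qed
  next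
    show "(\<Union>n. ?B n) \<in> sets (hold_space \<Otimes>\<^sub>M jump_space P)"
      using Bm unfolding C by (intro sets.countable_UN) blast
  next
    show "{\<omega> \<in> space (hold_space \<Otimes>\<^sub>M jump_space P). ctmc a t \<omega> = y} \<in> sets (hold_space \<Otimes>\<^sub>M jump_space P)"
      using Xm unfolding C .
  qed
  finally show ?thesis .
qed

lemma matrix_diff_mult: "(A - B) ** C = A ** C - B ** (C :: real^'a^'a)"
  and matrix_mult_diff: "C ** (A - B) = C ** A - C ** (B :: real^'a^'a)"
  by (simp_all add: matrix_matrix_mult_def vec_eq_iff algebra_simps sum_subtractf)

lemma matrix_power_diff:
  "(matrix_power (mat 1 - P) k ** matrix_power P j) $ x $ y
    = (\<Sum>i\<le>k. real (k choose i) * (- 1) ^ i * matrix_power P (i + j) $ x $ y)"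
proof (induction k arbitrary: j)
  case 0
  then show ?case by (simp add: matrix_power_0)
next
  case (Suc k)
  let ?q = "\<lambda>i. matrix_power P (i + j) $ x $ y"
  have "matrix_power (mat 1 - P) (Suc k) ** matrix_power P j
      = matrix_power (mat 1 - P) k ** (matrix_power P j - P ** matrix_power P j)"
    by (simp add: matrix_power_Suc_right matrix_mul_assoc[symmetric] matrix_diff_mult)
  also have "\<dots> = matrix_power (mat 1 - P) k ** matrix_power P j
      - matrix_power (mat 1 - P) k ** matrix_power P (Suc j)"
    by (simp add: matrix_mult_diff matrix_power_Suc)
  finally have "(matrix_power (mat 1 - P) (Suc k) ** matrix_power P j) $ x $ y =
      (\<Sum>i\<le>k. real (k choose i) * (- 1) ^ i * ?q i) -
      (\<Sum>i\<le>k. real (k choose i) * (- 1) ^ i * ?q (Suc i))"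
    by (simp add: Suc.IH)
  also have "(\<Sum>i\<le>k. real (k choose i) * (- 1) ^ i * ?q i)
      = (\<Sum>i\<le>Suc k. real (k choose i) * (- 1) ^ i * ?q i)"
    by simp
  also have "\<dots> = ?q 0 + (\<Sum>i\<le>k. real (k choose Suc i) * (- 1) ^ Suc i * ?q (Suc i))"
    by (subst sum.atMost_Suc_shift) simp
  finally have "(matrix_power (mat 1 - P) (Suc k) ** matrix_power P j) $ x $ y = ?q 0 +
      ((\<Sum>i\<le>k. real (k choose Suc i) * (- 1) ^ Suc i * ?q (Suc i)) -
       (\<Sum>i\<le>k. real (k choose i) * (- 1) ^ i * ?q (Suc i)))"
    by linarith
  also have "\<dots> = ?q 0 + (\<Sum>i\<le>k. real (Suc k choose Suc i) * (- 1) ^ Suc i * ?q (Suc i))"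
    unfolding sum_subtractf[symmetric]
    by (intro arg_cong2[where f="(+)"] refl sum.cong) (simp add: algebra_simps)
  also have "\<dots> = (\<Sum>i\<le>Suc k. real (Suc k choose i) * (- 1) ^ i * ?q i)"
    by (subst sum.atMost_Suc_shift) simp
  finally show ?case .
qed

lemma matrix_power_transition:
  assumes "transition_matrix P"
  shows "\<bar>matrix_power P n $ x $ y\<bar> \<le> 1"
proof -
  interpret J: prob_space "jump_space P" by (intro prob_space_PiM) (simp add: measure_pmf.prob_space_axioms)
  show ?thesis unfolding jump_law[OF assms, symmetric] by (simp add: J.prob_le_1)
qed

lemma heat_kernel_sums:
  assumes P: "transition_matrix P"
  shows "(\<lambda>k. ((- t) ^ k / fact k) *\<^sub>R matrix_power (mat 1 - P) k) sums
     (\<chi> x y. (\<Sum>n. t ^ n / fact n * matrix_power P n $ x $ y) * exp (- t))"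
  unfolding sums_def
proof (intro vec_tendstoI)
  fix x y
  define a b where "a n = t ^ n / fact n * matrix_power P n $ x $ y" and "b n = (- t) ^ n / fact n" for n
  have b: "b sums exp (- t)" "summable (\<lambda>n. norm (b n))"
    using exp_converges[of "- t"] summable_norm_exp[of "- t"] by (simp_all add: b_def[abs_def] field_simps)
  have "summable (\<lambda>n. norm (a n))"
  proof (rule summable_comparison_test'[where N=0])
    show "summable (\<lambda>n. \<bar>t\<bar> ^ n / fact n)"
      using summable_norm_exp[of t] by (simp add: field_simps power_abs)
    show "norm (norm (a n)) \<le> \<bar>t\<bar> ^ n / fact n" for n
      using matrix_power_transition[OF P, of n x y]
      by (simp add: a_def abs_mult power_abs divide_right_mono mult_left_le)
  qed
  from Cauchy_product_sums[OF this b(2)]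
  have "(\<lambda>k. \<Sum>i\<le>k. a i * b (k - i)) sums ((\<Sum>n. a n) * exp (- t))"
    using sums_unique[OF b(1)] by simp
  also have "(\<lambda>k. \<Sum>i\<le>k. a i * b (k - i)) = (\<lambda>k. (((- t) ^ k / fact k) *\<^sub>R matrix_power (mat 1 - P) k) $ x $ y)"
  proof
    fix k
    have "a i * b (k - i) = (- t) ^ k / fact k * (real (k choose i) * (- 1) ^ i * matrix_power P i $ x $ y)"
      if "i \<le> k" for i
    proof -
      have "(- t) ^ k = (- t) ^ i * (- t) ^ (k - i)" using that by (simp flip: power_add)
      moreover have "(- 1) ^ i * (- t) ^ i = t ^ i" by (simp flip: power_mult_distrib)
      ultimately have "t ^ i * (- t) ^ (k - i) = (- 1) ^ i * (- t) ^ k" by (metis mult.assoc)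
      then show ?thesis
        using that by (simp add: a_def b_def binomial_fact field_simps)
    qed
    then have "(\<Sum>i\<le>k. a i * b (k - i)) =
        (- t) ^ k / fact k * (\<Sum>i\<le>k. real (k choose i) * (- 1) ^ i * matrix_power P i $ x $ y)"
      by (simp add: sum_distrib_left)
    also have "(\<Sum>i\<le>k. real (k choose i) * (- 1) ^ i * matrix_power P i $ x $ y) = matrix_power (mat 1 - P) k $ x $ y"
      using matrix_power_diff[of P k 0 x y] by (simp add: matrix_power_0)
    finally show "(\<Sum>i\<le>k. a i * b (k - i)) = (((- t) ^ k / fact k) *\<^sub>R matrix_power (mat 1 - P) k) $ x $ y"
      by simp
  qed
  finally show "(\<lambda>n. (\<Sum>k<n. ((- t) ^ k / fact k) *\<^sub>R matrix_power (mat 1 - P) k) $ x $ y) \<longlonglongrightarrow>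
      (\<chi> x y. (\<Sum>n. t ^ n / fact n * matrix_power P n $ x $ y) * exp (- t)) $ x $ y"
    by (simp add: sums_def a_def)
qed

text \<open>The transition probabilities of the constructed process are given by the heat kernel.\<close>

lemma ctmc_heat_kernel:
  assumes P: "transition_matrix P" and t: "0 \<le> t"
  shows "measure (ctmc_space P) {\<omega> \<in> space (ctmc_space P). ctmc a t \<omega> = y} = heat_kernel P t $ a $ y"
proof -
  have "heat_kernel P t = (\<chi> x y. (\<Sum>n. t ^ n / fact n * matrix_power P n $ x $ y) * exp (- t))"
    unfolding heat_kernel_def using heat_kernel_sums[OF P] by (rule sums_unique[symmetric])
  moreover have "summable (\<lambda>n. t ^ n / fact n * matrix_power P n $ a $ y)"
  proof (rule summable_comparison_test'[where N=0])
    show "summable (\<lambda>n. t ^ n / fact n)"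
      using summable_norm_exp[of t] t by (simp add: field_simps)
    show "norm (t ^ n / fact n * matrix_power P n $ a $ y) \<le> t ^ n / fact n" for n
      using matrix_power_transition[OF P, of n a y] t by (simp add: abs_mult divide_right_mono mult_left_le)
  qed
  then have "(\<lambda>n. t ^ n / fact n * matrix_power P n $ a $ y * exp (- t)) sums
      ((\<Sum>n. t ^ n / fact n * matrix_power P n $ a $ y) * exp (- t))"
    by (intro sums_mult2 summable_sums)
  then have "(\<lambda>n. t ^ n / fact n * exp (- t) * matrix_power P n $ a $ y) sums
      ((\<Sum>n. t ^ n / fact n * matrix_power P n $ a $ y) * exp (- t))"
    by (simp only: mult_ac)
  ultimately show ?thesis
    using sums_unique2[OF ctmc_law[OF P t, of a y]] by simp
qed


lemma ctmc_right_continuous: "\<exists>u>t. \<forall>s\<in>{t..<u}. ctmc a s \<omega> = ctmc a t \<omega>"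
proof -
  obtain e F where \<omega>: "\<omega> = (e, F)" by (cases \<omega>)
  let ?S = "\<lambda>n. \<Sum>i\<le>n. e i"
  show ?thesis
  proof (cases "\<exists>n. t < ?S n")
    case True
    define N where "N = (LEAST n. t < ?S n)"
    have N: "t < ?S N" "\<And>m. m < N \<Longrightarrow> ?S m \<le> t"
      using LeastI_ex[OF True] not_less_Least[of _ "\<lambda>n. t < ?S n"] by (auto simp: N_def not_less)
    have "(LEAST n. s < ?S n) = N" if s: "s \<in> {t..<?S N}" for s
    proof (rule Least_equality)
      show "s < ?S N" using s by simp
      fix m assume "s < ?S m"
      then show "N \<le> m" using N(2)[of m] s by (cases "m < N") auto
    qed
    then have "ctmc a s \<omega> = jump_chain a F N" if "s \<in> {t..<?S N}" for s
      using that by (simp add: \<omega> ctmc_def)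
    with N(1) show ?thesis
      by (intro exI[of _ "?S N"]) simp
  next
    case False
    have *: "(\<lambda>n. s < ?S n) = (\<lambda>n. False)" if "t \<le> s" for s
    proof
      fix n
      have "?S n \<le> t" using False by (simp only: not_ex not_less)
      with that show "(s < ?S n) = False" by simp
    qed
    have "ctmc a s \<omega> = ctmc a t \<omega>" if "t \<le> s" for s
      by (simp only: \<omega> ctmc_def prod.case *[OF that] *[OF order_refl])
    then have "\<forall>s\<in>{t..<t + 1}. ctmc a s \<omega> = ctmc a t \<omega>" by (meson atLeastLessThan_iff)
    moreover have "t < t + 1" by simp
    ultimately show ?thesis by blast
  qed
qed

lemma measurable_hitting_time [measurable]: "hitting_time (ctmc a) A \<in> borel_measurable (ctmc_space P)"
proof (rule borel_measurableI_less)
  fix c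
  have "hitting_time (ctmc a) A \<omega> < c \<longleftrightarrow> (\<exists>q::rat. 0 \<le> q \<and> ereal (of_rat q) < c \<and> ctmc a (of_rat q) \<omega> \<in> A)" for \<omega>
  proof
    assume "hitting_time (ctmc a) A \<omega> < c"
    then obtain t where t: "0 \<le> t" "ctmc a t \<omega> \<in> A" "ereal t < c"
      unfolding hitting_time_def Inf_less_iff by blast
    obtain u where u: "t < u" "\<And>s. t \<le> s \<Longrightarrow> s < u \<Longrightarrow> ctmc a s \<omega> = ctmc a t \<omega>"
      using ctmc_right_continuous[of t a \<omega>] by (meson atLeastLessThan_iff)
    obtain v where v: "t < v" "ereal v < c"
      using ereal_dense2[OF t(3)] by auto
    obtain q where q: "t < of_rat q" "of_rat q < min u v"
      using of_rat_dense[of t "min u v"] u(1) v(1) by auto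
    have "0 < (of_rat q :: real)" using q(1) t(1) by linarith
    moreover have "ereal (of_rat q) < c"
      using q(2) v(2) by (intro less_trans[OF _ v(2)]) simp
    moreover have "ctmc a (of_rat q) \<omega> = ctmc a t \<omega>"
      using q by (intro u(2)) simp_all
    ultimately show "\<exists>q::rat. 0 \<le> q \<and> ereal (of_rat q) < c \<and> ctmc a (of_rat q) \<omega> \<in> A"
      using t(2) by (intro exI[of _ q]) simp
  next
    assume "\<exists>q::rat. 0 \<le> q \<and> ereal (of_rat q) < c \<and> ctmc a (of_rat q) \<omega> \<in> A"
    then obtain q :: rat where "0 \<le> q" "ereal (of_rat q) < c" "ctmc a (of_rat q) \<omega> \<in> A" by blast
    then show "hitting_time (ctmc a) A \<omega> < c"
      unfolding hitting_time_def Inf_less_iff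
      by (intro bexI[of _ "ereal (of_rat q)"]) auto
  qed
  then have "{\<omega> \<in> space (ctmc_space P). hitting_time (ctmc a) A \<omega> < c} =
    (\<Union>q\<in>{q::rat. 0 \<le> q \<and> ereal (of_rat q) < c}. ctmc a (of_rat q) -` A \<inter> space (ctmc_space P))"
    by blast
  also have "\<dots> \<in> sets (ctmc_space P)"
    by (intro sets.countable_UN' countableI_type image_subsetI measurable_sets[OF measurable_ctmc]) simp
  finally show "{\<omega> \<in> space (ctmc_space P). hitting_time (ctmc a) A \<omega> < c} \<in> sets (ctmc_space P)" .
qed

text \<open>The event in the definition of connectedness is measurable (otherwise its measure would be 0).\<close>

lemma sets_hitting_time_less:
  "{\<omega> \<in> space (ctmc_space P). hitting_time (ctmc a) A \<omega> < hitting_time (ctmc a) B \<omega>} \<in> sets (ctmc_space P)"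
  by (intro borel_measurable_less measurable_hitting_time)

definition connected_set :: "real^'a^'a \<Rightarrow> 'a set \<Rightarrow> bool" where
  "connected_set P A \<longleftrightarrow> A \<noteq> {} \<and>
     (\<forall>a\<in>A. \<forall>b\<in>A. 0 < measure (ctmc_space P)
        {\<omega> \<in> space (ctmc_space P). hitting_time (ctmc a) {b} \<omega> < hitting_time (ctmc a) (- A) \<omega>})"

definition measure_of_set :: "real^'a \<Rightarrow> 'a set \<Rightarrow> real" where
  "measure_of_set \<pi> A = (\<Sum>x\<in>A. \<pi> $ x)"

text \<open>
  Connectedness refers to the chain with transition matrix \<open>symmetrization P \<pi>\<close>; it is \<open>P\<close> itself
  when \<open>P\<close> is reversible.  Without reversibility, connectedness under \<open>P\<close> would leave too few sets:
  on a directed cycle only the singletons and the whole cycle are connected under \<open>P\<close>, so that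
  \<open>\<kappa>\<close> would be \<open>log n\<close> on the directed \<open>n\<close>-cycle, whereas \<open>t_rel\<close> has order \<open>n\<^sup>2\<close>.\<close>

definition con_half :: "real^'a^'a \<Rightarrow> real^'a \<Rightarrow> 'a set set" where
  "con_half P \<pi> = {A. connected_set (symmetrization P \<pi>) A \<and> measure_of_set \<pi> A \<le> 1 / 2}"

definition alpha_set :: "real^'a^'a \<Rightarrow> real^'a \<Rightarrow> 'a set \<Rightarrow> real" where
  "alpha_set P \<pi> A = lambda_set P \<pi> A / \<bar>ln (measure_of_set \<pi> A)\<bar>"

definition alpha :: "real^'a^'a \<Rightarrow> real^'a \<Rightarrow> real" where
  "alpha P \<pi> = (MIN A\<in>con_half P \<pi>. alpha_set P \<pi> A)"

definition kappa :: "real^'a^'a \<Rightarrow> real^'a \<Rightarrow> real" where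
  "kappa P \<pi> = 1 / alpha P \<pi>"

definition dirichlet :: "real^'a^'a \<Rightarrow> real^'a \<Rightarrow> real^'a \<Rightarrow> real" where
  "dirichlet P \<pi> f = (\<Sum>x\<in>UNIV. \<pi> $ x * f $ x * ((mat 1 - symmetrization P \<pi>) *v f) $ x)"

definition expect :: "real^'a \<Rightarrow> ('a \<Rightarrow> real) \<Rightarrow> real" where
  "expect \<pi> g = (\<Sum>x\<in>UNIV. \<pi> $ x * g x)"

definition entropy_of :: "real^'a \<Rightarrow> ('a \<Rightarrow> real) \<Rightarrow> real" where
  "entropy_of \<pi> g = expect \<pi> (\<lambda>x. g x * ln (g x)) - expect \<pi> g * ln (expect \<pi> g)"

definition log_sobolev_ratio :: "real^'a^'a \<Rightarrow> real^'a \<Rightarrow> real^'a \<Rightarrow> ereal" where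
  "log_sobolev_ratio P \<pi> f =
     (let d = entropy_of \<pi> (\<lambda>x. (f $ x)\<^sup>2) in if d = 0 then \<infinity> else ereal (dirichlet P \<pi> f / d))"

definition c_LS :: "real^'a^'a \<Rightarrow> real^'a \<Rightarrow> ereal" where
  "c_LS P \<pi> = (INF f\<in>{f. \<exists>x y. f $ x \<noteq> f $ y}. log_sobolev_ratio P \<pi> f)"

text \<open>In \<^typ>\<open>ereal\<close>, \<open>1 / 0 = \<infinity>\<close>; finiteness of \<open>t_LS\<close> entails \<open>c_LS \<noteq> 0\<close>.\<close>

definition t_LS :: "real^'a^'a \<Rightarrow> real^'a \<Rightarrow> ereal" where
  "t_LS P \<pi> = 1 / c_LS P \<pi>"

end

theory Submission
  imports Defs
begin

text \<open>
  Everything is expressed through the Dirichlet form \<open>energy\<close> of the symmetrized chain.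

  \<^bold>\<open>Lower bound on the log-Sobolev time.\<close>  The ground state of \<open>I - Q\<close> restricted to a set
  \<open>A\<close> is a test function for the log-Sobolev constant: its energy is \<open>\<lambda>(A)\<close> times its squared norm,
  and being concentrated on \<open>A\<close> costs it entropy at least \<open>|log \<pi>(A)|\<close> times its squared norm, by
  Jensen (\<open>entropy_ge_of_support\<close>).  Its ratio is thus at most \<open>\<alpha>(A)\<close>; take the minimizing \<open>A\<close>.

  \<^bold>\<open>Upper bound.\<close>  A function \<open>h\<close> supported in a set \<open>A\<close> with
  \<open>\<pi>(A) \<le> 1/2\<close> satisfies the Faber-Krahn inequality
  \<open>\<alpha> |log \<pi>(A)| \<parallel>h\<parallel>\<^sup>2 \<le> energy h\<close>: for connected \<open>A\<close> by definition of \<open>\<alpha>\<close>, and in general because the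
  energy splits over the components of \<open>A\<close> (\<open>faber_krahn\<close>).  Normalize \<open>f \<ge> 0\<close> by \<open>\<parallel>f\<parallel> = 1\<close> and let \<open>m\<close> be its mean,
  so that \<open>Ent(f\<^sup>2)\<close> is the mean of \<open>f\<^sup>2 log f\<^sup>2\<close>.  Cut \<open>f\<close> into the slices
  \<open>f\<^sub>k = min f 3\<^bsup>k+2\<^esup> - min f 3\<^bsup>k\<^esup>\<close>.
  The slice \<open>f\<^sub>k\<close> lives on \<open>{f > 3\<^bsup>k\<^esup>}\<close>, whose mass is at most \<open>9\<^bsup>-k\<^esup>\<close> by Markov, so Faber-Krahn gives
  \<open>k log 9 \<parallel>f\<^sub>k\<parallel>\<^sup>2 \<le> \<kappa> energy f\<^sub>k\<close>.  Every increment of \<open>f\<close> is seen by at most two slices, so the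
  energies of the slices add up to at most \<open>2 energy f\<close>; this is where the factor \<open>2\<close> in
  front of \<open>\<kappa>\<close> comes from.  It remains to compare pointwise
  (\<open>entropy_pointwise_bound\<close>): \<open>v\<^sup>2 log v\<^sup>2\<close> is at most the sum of
  \<open>k log 9\<close> times the squared slices of \<open>v\<close>, plus a multiple of \<open>v - m\<close>, which integrates to
  zero, plus \<open>2 (1 + log 49) (v - m)\<^sup>2\<close>, which integrates to at most
  \<open>2 (1 + log 49) t\<^sub>r\<^sub>e\<^sub>l energy f\<close> by the Poincare inequality.  For \<open>v \<le> 9\<close> the quadratic term
  suffices (second-order Taylor comparison at \<open>m\<close>); for larger \<open>v\<close> the top three slices recover
  all of \<open>v\<^sup>2 log v\<^sup>2\<close> except for an error \<open>O(v\<^sup>2)\<close>.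

  \<^bold>\<open>Relaxation time.\<close>  Faber-Krahn for the positive part of an eigenfunction of the spectral gap
  (or of its negative), whose support has mass at most \<open>1/2\<close>, gives \<open>\<alpha> log 2 \<le> \<lambda>\<close>.
\<close>

section \<open>The pointwise inequality for the entropy density\<close>

text \<open>This bound and the next one have an error of third order at \<open>r = 1\<close>.  That order is required:
  in the quadratic comparison below both sides agree up to second order at \<open>v = m\<close> when
  \<open>m = 1\<close> and \<open>R = max 1 v\<close>.\<close>

lemma ln_le_two_diff_over_sum:
  fixes r :: real
  assumes "0 < r" "r \<le> 1"
  shows "ln r \<le> 2 * (r - 1) / (r + 1)"
proof -
  have "ln r - 2 * (r - 1) / (r + 1) \<le> ln 1 - 2 * (1 - 1) / (1 + 1)"
  proof (rule DERIV_nonneg_imp_nondecreasing[OF assms(2)])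
    fix x assume x: "r \<le> x" "x \<le> 1"
    with assms have "0 < x" by simp
    then have "((\<lambda>r. ln r - 2 * (r - 1) / (r + 1)) has_real_derivative 1 / x - 4 / (x + 1)\<^sup>2) (at x)"
      by (auto intro!: derivative_eq_intros simp: power2_eq_square)
    moreover have "1 / x - 4 / (x + 1)\<^sup>2 = (x - 1)\<^sup>2 / (x * (x + 1)\<^sup>2)"
      using \<open>0 < x\<close> by (simp add: divide_simps) (simp add: power2_eq_square algebra_simps)
    ultimately show "\<exists>y. ((\<lambda>r. ln r - 2 * (r - 1) / (r + 1)) has_real_derivative y) (at x) \<and> 0 \<le> y"
      using \<open>0 < x\<close> by (intro exI conjI) auto
  qed
  then show ?thesis by simp
qed

lemma ln_le_half_diff_inverse:
  fixes r :: real
  assumes "1 \<le> r"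
  shows "ln r \<le> (r - 1 / r) / 2"
proof -
  have "(1 - 1 / 1) / 2 - ln 1 \<le> (r - 1 / r) / 2 - ln r"
  proof (rule DERIV_nonneg_imp_nondecreasing[OF assms])
    fix x assume x: "1 \<le> x" "x \<le> r"
    then have "((\<lambda>r. (r - 1 / r) / 2 - ln r) has_real_derivative (1 + 1 / (x * x)) / 2 - 1 / x) (at x)"
      by (auto intro!: derivative_eq_intros)
    moreover have "(1 + 1 / (x * x)) / 2 - 1 / x = (1 - 1 / x)\<^sup>2 / 2"
      using x by (simp add: power2_eq_square field_simps)
    ultimately show "\<exists>y. ((\<lambda>r. (r - 1 / r) / 2 - ln r) has_real_derivative y) (at x) \<and> 0 \<le> y"
      by (intro exI conjI) auto
  qed
  then show ?thesis by simp
qed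

text \<open>The linear term is the tangent of \<open>v\<^sup>2 ln v\<^sup>2\<close> at \<open>m\<close>, without its nonpositive constant
  \<open>m\<^sup>2 ln m\<^sup>2\<close>; half the second derivative is \<open>3 + ln v\<^sup>2\<close>, whence the coefficient of the quadratic
  term.  With \<open>v = m r\<close> the claim reduces to an inequality in \<open>r\<close> alone.\<close>

lemma entropy_le_quadratic:
  fixes m v R :: real
  assumes m: "0 < m" "m \<le> 1" and v: "0 \<le> v" "v \<le> R" and R: "1 \<le> R"
  shows "v\<^sup>2 * ln (v\<^sup>2) \<le> (2 * m * ln (m\<^sup>2) + 2 * m) * (v - m) + (3 + ln (R\<^sup>2)) * (v - m)\<^sup>2"
proof (cases "v = 0")
  case True
  have "0 \<le> ln R" "ln m \<le> 0" using m R by simp_all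
  then have "0 \<le> m\<^sup>2 * (1 + 2 * ln R - 4 * ln m)" by (intro mult_nonneg_nonneg) auto
  moreover have "ln (m\<^sup>2) = 2 * ln m" "ln (R\<^sup>2) = 2 * ln R" using m R by (simp_all add: ln_realpow)
  ultimately show ?thesis using True by (simp add: power2_eq_square algebra_simps)
next
  case False
  define r where "r = v / m"
  have r: "0 < r" "v = m * r" using False v m by (auto simp: r_def)
  have lm: "ln m \<le> 0" and lR: "0 \<le> ln R" using m R by simp_all
  have lv: "ln v = ln r + ln m" using m r by (simp add: ln_mult)
  have key: "2 * r\<^sup>2 * ln r - 2 * (r - 1) \<le> (r - 1)\<^sup>2 * (3 + 2 * ln R - 2 * ln m)"
  proof (cases "r \<le> 1")
    case True
    have "2 * r\<^sup>2 * ln r \<le> 2 * r\<^sup>2 * (2 * (r - 1) / (r + 1))"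
      using ln_le_two_diff_over_sum[OF r(1) True] by (intro mult_left_mono) auto
    also have "\<dots> \<le> (r - 1) * (3 * r - 1)"
    proof -
      have "(r - 1) * (4 * r\<^sup>2) \<le> (r - 1) * ((3 * r - 1) * (r + 1))"
        using True sum_squares_ge_zero[of "r - 1" 0]
        by (intro mult_left_mono_neg) (auto simp: power2_eq_square algebra_simps)
      then show ?thesis using r(1) by (simp add: divide_simps algebra_simps)
    qed
    also have "\<dots> = 2 * (r - 1) + (r - 1)\<^sup>2 * 3" by (simp add: power2_eq_square algebra_simps)
    also have "\<dots> \<le> 2 * (r - 1) + (r - 1)\<^sup>2 * (3 + 2 * ln R - 2 * ln m)"
      using lm lR by (intro add_left_mono mult_left_mono) auto
    finally show ?thesis by simp
  next
    case False
    have "ln v \<le> ln R" using v r m by (intro ln_mono) auto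
    have "2 * (2 * r - 1) * ln r \<le> 2 * (2 * r - 1) * ((r - 1 / r) / 2)"
      using ln_le_half_diff_inverse[of r] False by (intro mult_left_mono) auto
    also have "\<dots> \<le> (r - 1) * (3 * r - 1)"
    proof -
      have "(r - 1) * ((2 * r - 1) * (r + 1)) \<le> (r - 1) * ((3 * r - 1) * r)"
        using False sum_squares_ge_zero[of "r - 1" 0]
        by (intro mult_left_mono) (auto simp: power2_eq_square algebra_simps)
      then show ?thesis using r(1) by (simp add: divide_simps algebra_simps)
    qed
    finally have "2 * r\<^sup>2 * ln r - 2 * (r - 1) \<le> (r - 1)\<^sup>2 * (3 + 2 * ln r)"
      by (simp add: power2_eq_square algebra_simps)
    also have "\<dots> \<le> (r - 1)\<^sup>2 * (3 + 2 * ln R - 2 * ln m)"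
      using \<open>ln v \<le> ln R\<close> lv by (intro mult_left_mono) auto
    finally show ?thesis .
  qed
  have "m\<^sup>2 * (2 * r\<^sup>2 * ln r - 2 * (r - 1)) \<le> m\<^sup>2 * ((r - 1)\<^sup>2 * (3 + 2 * ln R - 2 * ln m))"
    using key by (rule mult_left_mono) simp
  moreover have "m\<^sup>2 * (2 * ln m) \<le> 0"
    using lm by (simp add: mult_nonneg_nonpos)
  moreover have "ln (v\<^sup>2) = 2 * (ln r + ln m)" "ln (m\<^sup>2) = 2 * ln m" "ln (R\<^sup>2) = 2 * ln R"
    using r m R lv by (simp_all add: ln_realpow)
  ultimately show ?thesis
    by (simp add: r(2) power2_eq_square algebra_simps)
qed

text \<open>Consecutive slices overlap, each height belonging to at most two of them.  Disjoint slices
  between consecutive powers have total energy at most that of \<open>f\<close> instead of twice as much, but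
  the sum of their squares can be less than half of \<open>v\<^sup>2\<close>, so that the coefficient of \<open>\<kappa>\<close> would
  exceed \<open>2\<close>.\<close>

definition slice :: "nat \<Rightarrow> real \<Rightarrow> real" where
  "slice k v = min v (3 ^ (k + 2)) - min v (3 ^ k)"

lemma slice_eq_0: "v \<le> 3 ^ k \<Longrightarrow> slice k v = 0"
  using power_increasing[of k "k + 2" "3::real", OF le_add1] unfolding slice_def min_def by (smt (verit))

lemma slice_diff_bounds:
  assumes "u \<le> v"
  shows "0 \<le> slice k v - slice k u" "slice k v - slice k u \<le> v - u"
  using assms power_increasing[of k "k + 2" "3::real", OF le_add1]
  unfolding slice_def min_def by (smt (verit))+

lemma sum_slice: "(\<Sum>k\<le>N. slice k v) = min v (3 ^ (N + 2)) + min v (3 ^ (N + 1)) - min v 3 - min v 1"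
  by (induction N) (auto simp: slice_def)

text \<open>A single slice moves at most as much as \<open>v\<close>, and all slices together at most twice as much,
  since their sum telescopes to two truncations of \<open>v\<close>.\<close>

lemma sum_slice_diff_squared_le: "(\<Sum>k\<le>N. (slice k v - slice k u)\<^sup>2) \<le> 2 * (v - u)\<^sup>2"
proof -
  have *: "(\<Sum>k\<le>N. (slice k v - slice k u)\<^sup>2) \<le> 2 * (v - u)\<^sup>2" if "u \<le> v" for u v
  proof -
    have "(\<Sum>k\<le>N. (slice k v - slice k u)\<^sup>2) \<le> (\<Sum>k\<le>N. (slice k v - slice k u) * (v - u))"
      unfolding power2_eq_square using slice_diff_bounds[OF that]
      by (intro sum_mono mult_left_mono) auto
    also have "\<dots> = ((\<Sum>k\<le>N. slice k v) - (\<Sum>k\<le>N. slice k u)) * (v - u)"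
      by (simp add: sum_distrib_right sum_subtractf[symmetric] left_diff_distrib)
    also have "\<dots> \<le> (2 * (v - u)) * (v - u)"
      unfolding sum_slice using that by (intro mult_right_mono) (auto simp: min_def)
    finally show ?thesis by (simp only: power2_eq_square mult.assoc)
  qed
  show ?thesis
    using *[of u v] *[of v u] by (cases "u \<le> v") (simp_all add: power2_commute)
qed

lemma ln_49_ge: "15 / 4 \<le> ln (49::real)"
proof -
  have "exp (15::real) = exp 1 ^ 15" by (simp flip: exp_of_nat_mult)
  also have "\<dots> \<le> (272 / 100) ^ 15" using e_less_272 by (intro power_mono) auto
  also have "\<dots> \<le> 49 ^ 4" by (simp add: power_divide)
  finally have "ln (exp (15::real)) \<le> ln (49 ^ 4)" by (intro ln_mono) auto
  also have "ln (49 ^ 4 :: real) = 4 * ln 49" by (subst ln_realpow) auto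
  finally show ?thesis by simp
qed

lemma ln_9_le: "ln (9::real) \<le> 9 / 4"
proof -
  have "(27 / 10 :: real) \<le> exp 1" using abs_le_D2[OF e_approx_32] by simp
  then have "(27 / 10 :: real) ^ 9 \<le> exp 1 ^ 9" by (intro power_mono) auto
  also have "exp 1 ^ 9 = exp (9::real)" by (simp flip: exp_of_nat_mult)
  finally have "(27 / 10 :: real) ^ 9 \<le> exp 9" .
  moreover have "(9::real) ^ 4 \<le> (27 / 10) ^ 9" by (simp add: power_divide)
  ultimately have "ln ((9::real) ^ 4) \<le> ln (exp 9)" by (intro ln_mono) auto
  also have "ln (9 ^ 4 :: real) = 4 * ln 9" by (subst ln_realpow) auto
  finally show ?thesis by simp
qed

text \<open>With \<open>y = 3\<^bsup>n\<^esup> \<le> v < 3 y\<close>, the top three slices have values \<open>v - y\<close>, \<open>v - y/3\<close> and \<open>8y/9\<close>, whose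
  squares add up to at least \<open>v\<^sup>2\<close>: the excess is a positive quadratic form in \<open>(v, y)\<close> because
  the ratio \<open>b = 3\<close> satisfies \<open>(1 + 1/b)\<^sup>2 < 2 - b\<^bsup>-2\<^esup> + b\<^bsup>-4\<^esup>\<close>.  Their weights \<open>n\<close>, \<open>n - 1\<close>, \<open>n - 2\<close> (times
  \<open>ln 9\<close>) are within a constant of \<open>ln v\<^sup>2 \<le> (n + 1) ln 9\<close>, which leaves an error of order \<open>v\<^sup>2\<close>.\<close>

lemma entropy_le_slices:
  assumes n: "2 \<le> n" "3 ^ n \<le> v" "v < 3 ^ (n + 1)" and "n \<le> N"
  shows "v\<^sup>2 * ln (v\<^sup>2) \<le> (\<Sum>k\<le>N. real k * ln 9 * (slice k v)\<^sup>2) + 245 / 81 * ln 9 * v\<^sup>2"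
proof -
  obtain j where j: "n = j + 2" using n(1) by (metis add.commute le_Suc_ex)
  define y :: real where "y = 3 ^ n"
  have y: "0 < y" "y \<le> v" "v < 3 * y" using n by (simp_all add: y_def)
  have s: "slice (Suc (Suc j)) v = v - y" "slice (Suc j) v = v - y / 3" "slice j v = 8 * y / 9"
    using y by (auto simp: slice_def y_def j min_def)
  have ln: "ln (v\<^sup>2) \<le> (real j + 3) * ln 9"
  proof -
    have "v\<^sup>2 \<le> (3 ^ (n + 1))\<^sup>2" using n y by (intro power_mono) auto
    also have "\<dots> = (3\<^sup>2) ^ (n + 1)" by (simp only: power_mult[symmetric] mult.commute)
    also have "\<dots> = 9 ^ (j + 3)" by (simp add: j power_add)
    finally have "ln (v\<^sup>2) \<le> ln (9 ^ (j + 3))" using y by (intro ln_mono) auto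
    then show ?thesis by (simp add: ln_realpow)
  qed
  have "v\<^sup>2 * ln (v\<^sup>2) \<le> v\<^sup>2 * ((real j + 3) * ln 9)" using ln by (rule mult_left_mono) simp
  also have "\<dots> \<le> ln 9 * ((real j + 2) * (v - y)\<^sup>2 + (real j + 1) * (v - y / 3)\<^sup>2 + real j * (8 * y / 9)\<^sup>2 + 245 / 81 * v\<^sup>2)"
  proof -
    have "v\<^sup>2 \<le> (v - y)\<^sup>2 + (v - y / 3)\<^sup>2 + (8 * y / 9)\<^sup>2"
    proof -
      have "(v - y)\<^sup>2 + (v - y / 3)\<^sup>2 + (8 * y / 9)\<^sup>2 = v\<^sup>2 + (v - 4 / 3 * y)\<^sup>2 + 10 / 81 * y\<^sup>2"
        by (simp add: power2_eq_square algebra_simps)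
      then show ?thesis by simp
    qed
    then have "real n * v\<^sup>2 \<le> real n * ((v - y)\<^sup>2 + (v - y / 3)\<^sup>2 + (8 * y / 9)\<^sup>2)"
      by (rule mult_left_mono) simp
    \<comment> \<open>the left side is convex in \<open>y\<close>, and of the ends of \<open>0 \<le> y \<le> v\<close> the worse is \<open>y = v\<close>\<close>
    moreover have "(v - y / 3)\<^sup>2 + 2 * (8 * y / 9)\<^sup>2 \<le> 164 / 81 * v\<^sup>2"
    proof -
      have "0 \<le> (v - y) * (83 * v + 137 * y)" using y by (intro mult_nonneg_nonneg) auto
      then show ?thesis by (simp add: power2_eq_square algebra_simps)
    qed
    ultimately have "v\<^sup>2 * (real j + 3) \<le> (real j + 2) * (v - y)\<^sup>2 + (real j + 1) * (v - y / 3)\<^sup>2 + real j * (8 * y / 9)\<^sup>2 + 245 / 81 * v\<^sup>2"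
      by (simp add: j algebra_simps)
    then have "ln 9 * (v\<^sup>2 * (real j + 3)) \<le> ln 9 * ((real j + 2) * (v - y)\<^sup>2 + (real j + 1) * (v - y / 3)\<^sup>2 + real j * (8 * y / 9)\<^sup>2 + 245 / 81 * v\<^sup>2)"
      by (rule mult_left_mono) simp
    then show ?thesis by (simp add: algebra_simps)
  qed
  also have "\<dots> = (\<Sum>k\<in>{j, j + 1, n}. real k * ln 9 * (slice k v)\<^sup>2) + 245 / 81 * ln 9 * v\<^sup>2"
    by (simp add: s j algebra_simps)
  also have "(\<Sum>k\<in>{j, j + 1, n}. real k * ln 9 * (slice k v)\<^sup>2) \<le> (\<Sum>k\<le>N. real k * ln 9 * (slice k v)\<^sup>2)"
    using \<open>n \<le> N\<close> by (intro sum_mono2) (auto simp: j)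
  finally show ?thesis by simp
qed

text \<open>The threshold \<open>9\<close> is low enough for \<open>3 + ln 9\<^sup>2 \<le> 2 (1 + ln 49)\<close>, which settles \<open>v \<le> 9\<close>, and high
  enough for the linear term and the shift by \<open>m\<close>, both of order \<open>v\<close>, to leave enough of
  \<open>2 (1 + ln 49) (v - m)\<^sup>2\<close> to absorb the error \<open>245/81 ln 9 v\<^sup>2\<close> of the slices.\<close>

lemma entropy_pointwise_bound:
  fixes m v :: real
  assumes m: "0 < m" "m \<le> 1" and v: "0 \<le> v" "v < 3 ^ (N + 1)"
  shows "v\<^sup>2 * ln (v\<^sup>2) \<le> (2 * m * ln (m\<^sup>2) + 2 * m) * (v - m) + 2 * (1 + ln 49) * (v - m)\<^sup>2
    + (\<Sum>k\<le>N. real k * ln 9 * (slice k v)\<^sup>2)"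
proof (cases "v \<le> 9")
  case True
  have "ln ((9::real)\<^sup>2) = 2 * ln 9" by (subst ln_realpow) auto
  then have "3 + ln ((9::real)\<^sup>2) \<le> 2 * (1 + ln 49)" using ln_9_le ln_49_ge by simp
  then have "(3 + ln (9\<^sup>2)) * (v - m)\<^sup>2 \<le> 2 * (1 + ln 49) * (v - m)\<^sup>2" by (rule mult_right_mono) simp
  with entropy_le_quadratic[OF m v(1) True]
  have "v\<^sup>2 * ln (v\<^sup>2) \<le> (2 * m * ln (m\<^sup>2) + 2 * m) * (v - m) + 2 * (1 + ln 49) * (v - m)\<^sup>2" by simp
  moreover have "0 \<le> (\<Sum>k\<le>N. real k * ln 9 * (slice k v)\<^sup>2)" by (intro sum_nonneg) auto
  ultimately show ?thesis by linarith
next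
  case False
  define n where "n = (LEAST n. v < 3 ^ (n + 1))"
  have n1: "v < 3 ^ (n + 1)" unfolding n_def using v(2) by (rule LeastI)
  have nN: "n \<le> N" unfolding n_def using v(2) by (rule Least_le)
  have n2: "2 \<le> n"
  proof (rule ccontr)
    assume "\<not> 2 \<le> n"
    then have "(3::real) ^ (n + 1) \<le> 3 ^ 2" by (intro power_increasing) auto
    with n1 False show False by simp
  qed
  have n3: "3 ^ n \<le> v"
  proof (rule ccontr)
    assume "\<not> 3 ^ n \<le> v"
    then have "v < 3 ^ (n - 1 + 1)" using n2 by simp
    then have "n \<le> n - 1" unfolding n_def by (rule Least_le)
    with n2 show False by simp
  qed
  let ?C = "2 * (1 + ln (49::real))"
  have C: "19 / 2 \<le> ?C" using ln_49_ge by simp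
  \<comment> \<open>the slope is at least \<open>6 m - 4\<close>, because \<open>m ln m \<ge> m - 1\<close>\<close>
  have lin: "- 4 * v \<le> (2 * m * ln (m\<^sup>2) + 2 * m) * (v - m)"
  proof -
    have "m * ln (1 / m) \<le> m * (1 / m - 1)" using m by (intro mult_left_mono ln_le_minus_one) auto
    then have "m - 1 \<le> m * ln m" using m by (simp add: ln_div right_diff_distrib)
    then have b: "- 4 \<le> 2 * m * ln (m\<^sup>2) + 2 * m" using m by (simp add: ln_realpow)
    have "- 4 * v \<le> - 4 * (v - m)" using m by simp
    also have "\<dots> \<le> (2 * m * ln (m\<^sup>2) + 2 * m) * (v - m)"
      using b False m by (intro mult_right_mono) auto
    finally show ?thesis .
  qed
  have quad: "v * (v - 2) \<le> (v - m)\<^sup>2"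
  proof -
    have "(v - m)\<^sup>2 - v * (v - 2) = m\<^sup>2 + 2 * (v * (1 - m))" by (simp add: power2_eq_square algebra_simps)
    moreover have "0 \<le> v * (1 - m)" using m v by simp
    ultimately show ?thesis by (smt (verit) zero_le_power2)
  qed
  have "245 / 81 * ln 9 * v\<^sup>2 \<le> 245 / 81 * (9 / 4) * v\<^sup>2"
    using ln_9_le by (intro mult_right_mono mult_left_mono) auto
  also have "\<dots> \<le> 19 / 2 * (v * (v - 2)) - 4 * v"
  proof -
    have "19 / 2 * (v - 2) - 4 - 245 / 36 * v = (97 * v - 828) / 36" by (simp add: field_simps)
    then have "0 \<le> 19 / 2 * (v - 2) - 4 - 245 / 36 * v" using False by simp
    then have "0 \<le> v * (19 / 2 * (v - 2) - 4 - 245 / 36 * v)" using v(1) by (rule mult_nonneg_nonneg[rotated])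
    then show ?thesis by (simp add: power2_eq_square algebra_simps)
  qed
  also have "19 / 2 * (v * (v - 2)) \<le> ?C * (v - m)\<^sup>2"
    using C quad False by (intro mult_mono) auto
  finally have "245 / 81 * ln 9 * v\<^sup>2 \<le> ?C * (v - m)\<^sup>2 + (2 * m * ln (m\<^sup>2) + 2 * m) * (v - m)"
    using lin by simp
  with entropy_le_slices[OF n2 n3 n1 nN] show ?thesis by linarith
qed

text \<open>The claim amounts to \<open>49 e < 2\<^bsup>15/2\<^esup>\<close>.\<close>

lemma kappa_coefficient_less_17: "2 * (1 + (1 + ln 49) / ln 2) < (17::real)"
proof -
  have "(49 * exp 1)\<^sup>2 < (49 * (272 / 100 :: real))\<^sup>2"
    using e_less_272 by (intro power_strict_mono) auto
  also have "\<dots> < 2 ^ 15" by (simp add: power2_eq_square)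
  finally have "ln ((49 * exp (1::real))\<^sup>2) < ln (2 ^ 15)"
    by (subst ln_less_cancel_iff) auto
  moreover have "ln ((49 * exp (1::real))\<^sup>2) = 2 * (ln 49 + 1)" by (subst ln_realpow) (auto simp: ln_mult)
  moreover have "ln (2 ^ 15 :: real) = 15 * ln 2" by (subst ln_realpow) auto
  ultimately have "2 * (ln 49 + 1) < 15 * ln (2::real)" by (simp only:)
  then have "1 + ln 49 < 15 / 2 * ln (2::real)" by simp
  then have "(1 + ln 49) / ln (2::real) < 15 / 2" by (simp add: divide_less_eq)
  then have "2 * (1 + (1 + ln 49) / ln (2::real)) < 2 * (1 + 15 / 2)"
    by (intro mult_strict_left_mono add_strict_left_mono) auto
  also have "2 * (1 + 15 / 2) = (17 :: real)" by simp
  finally show ?thesis .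
qed

section \<open>Minimizers of Rayleigh quotients\<close>

text \<open>A minimizer of the quotient exists by compactness of the unit sphere; the weak eigenvalue
  equation is the first-order condition for \<open>B - \<mu> N \<ge> 0\<close> along \<open>f + t g\<close>.\<close>

lemma rayleigh_minimizer:
  fixes B N :: "'v::euclidean_space \<Rightarrow> 'v \<Rightarrow> real"
  assumes B: "bilinear B" "\<And>f g. B f g = B g f"
    and N: "bilinear N" "\<And>f g. N f g = N g f" "\<And>f. f \<noteq> 0 \<Longrightarrow> 0 < N f f"
    and V: "subspace V" "v \<in> V" "v \<noteq> 0"
  obtains f \<mu> where "f \<in> V" "f \<noteq> 0" "\<And>g. g \<in> V \<Longrightarrow> B f g = \<mu> * N f g"
    "\<And>g. g \<in> V \<Longrightarrow> \<mu> * N g g \<le> B g g"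
proof -
  let ?S = "V \<inter> sphere 0 1" and ?q = "\<lambda>f. B f f / N f f"
  interpret B: bounded_bilinear B using B(1) by (simp add: bilinear_conv_bounded_bilinear)
  interpret N: bounded_bilinear N using N(1) by (simp add: bilinear_conv_bounded_bilinear)
  have "compact ?S" using V(1) by (intro closed_Int_compact closed_subspace compact_sphere)
  moreover have "(1 / norm v) *\<^sub>R v \<in> ?S" using V by (simp add: subspace_scale)
  moreover have "continuous_on ?S ?q"
  proof (intro continuous_intros B.continuous_on N.continuous_on ballI)
    fix f assume "f \<in> ?S"
    then have "f \<noteq> 0" by auto
    then show "N f f \<noteq> 0" using N(3)[of f] by simp
  qed
  ultimately obtain f where f: "f \<in> ?S" "\<And>g. g \<in> ?S \<Longrightarrow> ?q f \<le> ?q g"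
    using continuous_attains_inf[of ?S ?q] by blast
  define \<mu> where "\<mu> = ?q f"
  have f0: "f \<noteq> 0" "f \<in> V" using f(1) by auto
  then have \<mu>: "B f f = \<mu> * N f f" using N(3)[of f] by (simp add: \<mu>_def)
  have min: "\<mu> * N g g \<le> B g g" if g: "g \<in> V" for g
  proof (cases "g = 0")
    case True
    then show ?thesis by (simp add: B.zero_left N.zero_left)
  next
    case False
    with g V(1) have "(1 / norm g) *\<^sub>R g \<in> ?S" by (simp add: subspace_scale)
    from f(2)[OF this] have "\<mu> \<le> ?q g"
      using False by (simp add: \<mu>_def B.scaleR_left B.scaleR_right N.scaleR_left N.scaleR_right)
    then show ?thesis using N(3)[OF False] by (simp add: le_divide_eq)
  qed
  have "B f g = \<mu> * N f g" if g: "g \<in> V" for g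
  proof (rule ccontr)
    assume *: "B f g \<noteq> \<mu> * N f g"
    define \<beta> \<gamma> where "\<beta> = B f g - \<mu> * N f g" and "\<gamma> = B g g - \<mu> * N g g"
    \<comment> \<open>a step against the sign of \<open>\<beta>\<close>, short enough for the term \<open>2 t \<beta>\<close> to beat \<open>t\<^sup>2 \<gamma>\<close>\<close>
    define t where "t = - \<beta> / (\<gamma> + 1)"
    have \<gamma>: "0 \<le> \<gamma>" using min[OF g] by (simp add: \<gamma>_def)
    have "f + t *\<^sub>R g \<in> V" using f0 g V(1) by (simp add: subspace_add subspace_scale)
    from min[OF this] have "0 \<le> 2 * t * \<beta> + t * t * \<gamma>"
      using \<mu> by (simp add: \<beta>_def \<gamma>_def B.add_left B.add_right N.add_left N.add_right B.scaleR_left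
        B.scaleR_right N.scaleR_left N.scaleR_right B(2)[of g f] N(2)[of g f] algebra_simps)
    moreover have "2 * t * \<beta> + t * t * \<gamma> = - (\<beta>\<^sup>2 * (\<gamma> + 2)) / (\<gamma> + 1)\<^sup>2"
    proof -
      have "t * (\<gamma> + 1) = - \<beta>" using \<gamma> by (simp add: t_def)
      then have "(2 * t * \<beta> + t * t * \<gamma>) * (\<gamma> + 1)\<^sup>2 = - (\<beta>\<^sup>2 * (\<gamma> + 2))"
        by algebra
      moreover have "(\<gamma> + 1)\<^sup>2 \<noteq> 0" using \<gamma> by simp
      ultimately show ?thesis by (metis nonzero_mult_div_cancel_right)
    qed
    moreover have "0 < \<beta>\<^sup>2 * (\<gamma> + 2) / (\<gamma> + 1)\<^sup>2"
      using * \<gamma> by (intro divide_pos_pos mult_pos_pos) (auto simp: \<beta>_def)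
    ultimately show False by simp
  qed
  with f0 min show ?thesis using that by blast
qed

section \<open>Connected sets and paths\<close>

text \<open>The following event has positive probability: exactly \<open>n\<close> jumps occur up to time \<open>1\<close>, and they
  follow the path \<open>x\<close>.  On it \<open>b\<close> is hit by time \<open>1\<close>, whereas the chain stays in \<open>A\<close> up to its next
  jump, which comes after time \<open>1\<close>.\<close>

lemma path_imp_hit_before_exit:
  fixes M :: "real^'a^'a"
  assumes M: "transition_matrix M" and x: "x 0 = a" "x n = b" "\<And>i. i \<le> n \<Longrightarrow> x i \<in> A"
    and step: "\<And>i. i < n \<Longrightarrow> 0 < M $ x i $ x (Suc i)"
  shows "0 < measure (ctmc_space M)
     {\<omega> \<in> space (ctmc_space M). hitting_time (ctmc a) {b} \<omega> < hitting_time (ctmc a) (- A) \<omega>}"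
    (is "0 < measure _ ?hit")
proof -
  interpret H: prob_space hold_space by (rule prob_space_hold)
  interpret J: prob_space "jump_space M" by (intro prob_space_PiM) (simp add: measure_pmf.prob_space_axioms)
  interpret HJ: pair_prob_space hold_space "jump_space M" ..
  have C: "ctmc_space M = hold_space \<Otimes>\<^sub>M jump_space M" by (simp add: ctmc_space_def)
  define I where "I = (\<lambda>i. (i, x i)) ` {..<n}"
  define E where "E = {F. \<forall>i\<in>I. F i = x (Suc (fst i))}"
  have "measure (jump_space M) E = (\<Prod>i\<in>I. M $ snd i $ x (Suc (fst i)))"
    using jump_law_aux[OF M, of I 0 a a "\<lambda>i. x (Suc (fst i))"] by (simp add: E_def I_def matrix_power_0 mat_def)
  also have "\<dots> > 0" using step by (intro prod_pos) (auto simp: I_def)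
  finally have Epos: "0 < measure (jump_space M) E" .
  have Em: "E \<in> sets (jump_space M)" using Epos measure_notin_sets by fastforce
  have chain: "jump_chain a F i = x i" if "F \<in> E" "i \<le> n" for F i
    using that(2) by (induction i) (use that(1) x(1) in \<open>auto simp: E_def I_def\<close>)
  have "jumps_at 1 n \<times> E \<subseteq> ?hit"
  proof
    fix \<omega> assume "\<omega> \<in> jumps_at 1 n \<times> E"
    then obtain e F where \<omega>: "\<omega> = (e, F)" and e: "e \<in> jumps_at 1 n" and F: "F \<in> E" by auto
    let ?s = "\<Sum>i\<le>n. e i"
    have "(LEAST n. 1 < (\<Sum>i\<le>n. e i)) = n"
      using e unfolding jumps_at_def by (intro Least_equality) (auto simp: not_less[symmetric])
    then have "ctmc a 1 \<omega> = b" using chain[OF F order_refl] x(2) by (simp add: \<omega> ctmc_def)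
    then have "hitting_time (ctmc a) {b} \<omega> \<le> ereal 1"
      unfolding hitting_time_def by (intro Inf_lower) auto
    also have "\<dots> < ereal ?s" using e by (simp add: jumps_at_def)
    also have "ereal ?s \<le> hitting_time (ctmc a) (- A) \<omega>"
      unfolding hitting_time_def
    proof (rule Inf_greatest)
      fix u assume "u \<in> {ereal t |t. 0 \<le> t \<and> ctmc a t \<omega> \<in> - A}"
      then obtain t where t: "u = ereal t" "ctmc a t \<omega> \<notin> A" by auto
      have "?s \<le> t"
      proof (rule ccontr)
        assume "\<not> ?s \<le> t"
        then have "(LEAST n. t < (\<Sum>i\<le>n. e i)) \<le> n" by (intro Least_le) simp
        with t(2) chain[OF F] x(3) show False by (simp add: \<omega> ctmc_def)
      qed
      with t(1) show "ereal ?s \<le> u" by simp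
    qed
    finally show "\<omega> \<in> ?hit"
      by (simp add: C \<omega> space_pair_measure space_hold_space space_jump_space)
  qed
  then have "measure (ctmc_space M) (jumps_at 1 n \<times> E) \<le> measure (ctmc_space M) ?hit"
    using sets_hitting_time_less[of M a "{b}" "- A"] unfolding C by (intro HJ.P.finite_measure_mono) auto
  moreover have "measure (ctmc_space M) (jumps_at 1 n \<times> E) = measure hold_space (jumps_at 1 n) * measure (jump_space M) E"
    using Em by (simp add: C measure_def enn2real_mult J.emeasure_pair_measure_Times)
  moreover have "0 < measure hold_space (jumps_at 1 n)" by (simp add: jumps_at_law)
  ultimately show ?thesis using Epos by (smt (verit) mult_pos_pos)
qed

text \<open>The states that are reachable from a point of \<open>A\<close> along paths inside \<open>A\<close> form a part with no
  transition to the rest of \<open>A\<close>, and this part is proper if some point of \<open>A\<close> cannot be hit before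
  leaving \<open>A\<close>.\<close>

lemma connected_or_split:
  fixes M :: "real^'a^'a"
  assumes M: "transition_matrix M" and A: "A \<noteq> {}" "\<not> connected_set M A"
  obtains B where "B \<noteq> {}" "B \<subset> A" "\<And>x y. x \<in> B \<Longrightarrow> y \<in> A - B \<Longrightarrow> M $ x $ y = 0"
proof -
  obtain a b where ab: "a \<in> A" "b \<in> A" "\<not> 0 < measure (ctmc_space M)
     {\<omega> \<in> space (ctmc_space M). hitting_time (ctmc a) {b} \<omega> < hitting_time (ctmc a) (- A) \<omega>}"
    using A unfolding connected_set_def by blast
  define R where "R = {(x, y). x \<in> A \<and> y \<in> A \<and> 0 < M $ x $ y}"
  define B where "B = {y. (a, y) \<in> R\<^sup>*}"
  have BA: "B \<subseteq> A" using ab(1) by (auto simp: B_def R_def elim: rtranclE)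
  have "b \<notin> B"
  proof
    assume "b \<in> B"
    then obtain n where "(a, b) \<in> R ^^ n" unfolding B_def using rtrancl_imp_relpow by fastforce
    then obtain x where x: "x 0 = a" "x n = b" "\<And>i. i < n \<Longrightarrow> (x i, x (Suc i)) \<in> R"
      unfolding relpow_fun_conv by blast
    have "x i \<in> A" if "i \<le> n" for i
      using that x ab by (cases "i = n") (auto simp: R_def)
    with path_imp_hit_before_exit[OF M x(1,2)] x(3) ab(3) show False by (auto simp: R_def)
  qed
  moreover have "M $ x $ y = 0" if "x \<in> B" "y \<in> A - B" for x y
  proof (rule ccontr)
    assume "M $ x $ y \<noteq> 0"
    then have "(x, y) \<in> R" using that M BA by (auto simp: R_def transition_matrix_def less_le)
    with that show False by (auto simp: B_def intro: rtrancl_into_rtrancl)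
  qed
  moreover have "a \<in> B" by (simp add: B_def)
  ultimately show ?thesis using that[of B] BA ab(2) by blast
qed

section \<open>The Dirichlet form of an irreducible chain\<close>

lemma vec_nth_vec_lambda: "($) (\<chi> x. h x) = h"
  by (rule ext) simp

locale irreducible_chain =
  fixes P :: "real^'a^'a" and \<pi> :: "real^'a"
  assumes two_states: "2 \<le> CARD('a)"
    and P: "transition_matrix P"
    and irred: "irreducible_matrix P"
    and stat: "stationary_distribution P \<pi>"
begin

abbreviation Q :: "real^'a^'a" where "Q \<equiv> symmetrization P \<pi>"

definition conductance :: "'a \<Rightarrow> 'a \<Rightarrow> real" where "conductance x y = \<pi> $ x * Q $ x $ y"

definition inner_pi :: "('a \<Rightarrow> real) \<Rightarrow> ('a \<Rightarrow> real) \<Rightarrow> real" where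
  "inner_pi f g = (\<Sum>x\<in>UNIV. \<pi> $ x * f x * g x)"

definition energy :: "('a \<Rightarrow> real) \<Rightarrow> ('a \<Rightarrow> real) \<Rightarrow> real" where
  "energy f g = (\<Sum>x\<in>UNIV. \<Sum>y\<in>UNIV. conductance x y * ((f x - f y) * (g x - g y))) / 2"

lemma P_nonneg: "0 \<le> P $ x $ y" and P_sum: "(\<Sum>y\<in>UNIV. P $ x $ y) = 1"
  using P by (auto simp: transition_matrix_def)

lemma pi_sum: "(\<Sum>x\<in>UNIV. \<pi> $ x) = 1" and pi_P: "(\<Sum>x\<in>UNIV. \<pi> $ x * P $ x $ y) = \<pi> $ y"
proof -
  show "(\<Sum>x\<in>UNIV. \<pi> $ x) = 1" using stat by (simp add: stationary_distribution_def)
  have "(\<pi> v* P) $ y = \<pi> $ y" using stat by (simp add: stationary_distribution_def)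
  then show "(\<Sum>x\<in>UNIV. \<pi> $ x * P $ x $ y) = \<pi> $ y" by (simp add: vector_matrix_mult_def mult.commute)
qed

text \<open>Some state has positive mass, and \<open>\<pi> P\<^sup>n = \<pi>\<close> carries mass from it to every state it reaches.\<close>

lemma pi_pos: "0 < \<pi> $ y"
proof -
  have nn: "0 \<le> \<pi> $ x" for x using stat by (simp add: stationary_distribution_def)
  have Pn: "0 \<le> matrix_power P n $ x $ y" for n x y
    using jump_law[OF P, of x n y] measure_nonneg by metis
  have inv: "\<pi> v* matrix_power P n = \<pi>" for n
  proof (induction n)
    case (Suc n)
    then show ?case using stat
      by (simp add: matrix_power_Suc_right vector_matrix_mul_assoc[symmetric] stationary_distribution_def)
  qed (simp add: matrix_power_0)
  obtain x where x: "0 < \<pi> $ x"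
    using pi_sum nn by (metis less_eq_real_def sum.neutral zero_neq_one)
  obtain n where n: "0 < matrix_power P n $ x $ y"
    using irred by (auto simp: irreducible_matrix_def)
  have "0 < \<pi> $ x * matrix_power P n $ x $ y" using x n by simp
  also have "\<dots> \<le> (\<Sum>z\<in>UNIV. \<pi> $ z * matrix_power P n $ z $ y)"
    using nn Pn by (intro member_le_sum) auto
  also have "\<dots> = (\<pi> v* matrix_power P n) $ y" by (simp add: vector_matrix_mult_def mult.commute)
  finally show ?thesis by (simp add: inv)
qed

lemma conductance_eq: "conductance x y = (\<pi> $ x * P $ x $ y + \<pi> $ y * P $ y $ x) / 2"
  using pi_pos[of x] by (simp add: conductance_def symmetrization_def time_reversal_def field_simps)

lemma conductance_sym: "conductance x y = conductance y x" and conductance_nonneg: "0 \<le> conductance x y"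
  using pi_pos P_nonneg by (simp_all add: conductance_eq less_imp_le)

lemma conductance_sum: "(\<Sum>y\<in>UNIV. conductance x y) = \<pi> $ x" "(\<Sum>x\<in>UNIV. conductance x y) = \<pi> $ y"
proof -
  show *: "(\<Sum>y\<in>UNIV. conductance x y) = \<pi> $ x" for x
    by (simp add: conductance_eq sum_divide_distrib[symmetric] sum.distrib sum_distrib_left[symmetric] P_sum pi_P)
  show "(\<Sum>x\<in>UNIV. conductance x y) = \<pi> $ y" using *[of y] by (subst conductance_sym)
qed

lemma transition_matrix_Q: "transition_matrix Q"
  unfolding transition_matrix_def
proof (intro conjI allI)
  have Q: "Q $ x $ y = conductance x y / \<pi> $ x" for x y using pi_pos[of x] by (simp add: conductance_def)
  show "0 \<le> Q $ x $ y" for x y using pi_pos[of x] conductance_nonneg by (simp add: Q)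
  show "(\<Sum>y\<in>UNIV. Q $ x $ y) = 1" for x
    using pi_pos[of x] conductance_sum(1)[of x] by (simp add: Q sum_divide_distrib[symmetric])
qed

lemma inner_pi_nonneg: "0 \<le> inner_pi f f"
  unfolding inner_pi_def using pi_pos by (intro sum_nonneg) (simp add: less_imp_le mult.assoc)

lemma inner_pi_pos:
  assumes "f x \<noteq> 0"
  shows "0 < inner_pi f f"
proof -
  have "0 < \<pi> $ x * f x * f x" using assms pi_pos[of x] by (simp add: mult.assoc zero_less_mult_iff linorder_neq_iff disj_commute)
  also have "\<dots> \<le> inner_pi f f"
    unfolding inner_pi_def using pi_pos by (intro member_le_sum) (auto simp: less_imp_le mult.assoc)
  finally show ?thesis .
qed

lemma energy_nonneg: "0 \<le> energy f f"
  unfolding energy_def using conductance_nonneg by (simp add: sum_nonneg)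

lemma energy_sym: "energy f g = energy g f" and inner_pi_sym: "inner_pi f g = inner_pi g f"
  by (simp_all add: energy_def inner_pi_def mult_ac)

lemma energy_expand: "energy f g = inner_pi f g - (\<Sum>x\<in>UNIV. \<Sum>y\<in>UNIV. conductance x y * (f x * g y))"
proof -
  let ?S = "\<lambda>h. \<Sum>x\<in>UNIV. \<Sum>y\<in>UNIV. conductance x y * h x y"
  have "?S (\<lambda>x y. f x * g x) = inner_pi f g"
    by (simp add: sum_distrib_right[symmetric] conductance_sum inner_pi_def mult.assoc)
  moreover have "?S (\<lambda>x y. f y * g y) = inner_pi f g"
    by (subst sum.swap) (simp add: sum_distrib_right[symmetric] conductance_sum inner_pi_def mult.assoc)
  moreover have "?S (\<lambda>x y. f y * g x) = ?S (\<lambda>x y. f x * g y)"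
    by (subst sum.swap) (simp add: conductance_sym)
  moreover have "?S (\<lambda>x y. (f x - f y) * (g x - g y)) =
     ?S (\<lambda>x y. f x * g x) + ?S (\<lambda>x y. f y * g y) - ?S (\<lambda>x y. f x * g y) - ?S (\<lambda>x y. f y * g x)"
    by (simp add: algebra_simps sum.distrib sum_subtractf)
  ultimately show ?thesis by (simp add: energy_def)
qed

text \<open>Turns eigenvalue equations for \<open>I - Q\<close> into equations between the two bilinear forms, so that
  the variational lemma applies.\<close>

lemma generator_weak_form:
  "(\<Sum>x\<in>UNIV. \<pi> $ x * g x * ((mat 1 - Q) *v f) $ x) = energy (($) f) g"
proof -
  have "(\<Sum>x\<in>UNIV. \<pi> $ x * g x * ((mat 1 - Q) *v f) $ x)
     = inner_pi g (($) f) - (\<Sum>x\<in>UNIV. \<Sum>y\<in>UNIV. conductance x y * (g x * f $ y))"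
    by (simp add: matrix_vector_mult_diff_rdistrib right_diff_distrib sum_subtractf inner_pi_def
        matrix_vector_mult_def[of Q] sum_distrib_left conductance_def mult_ac)
  then show ?thesis by (simp add: energy_expand[symmetric] energy_sym)
qed

lemma dirichlet_eq_energy: "dirichlet P \<pi> f = energy (($) f) (($) f)"
  by (simp add: dirichlet_def generator_weak_form)

lemma bilinear_energy: "bilinear (\<lambda>f g :: real^'a. energy (($) f) (($) g))"
  and bilinear_inner_pi: "bilinear (\<lambda>f g :: real^'a. inner_pi (($) f) (($) g))"
  by (auto intro!: linearI simp: bilinear_def energy_def inner_pi_def sum.distrib[symmetric] sum_distrib_left
      add_divide_distrib[symmetric] algebra_simps)

text \<open>Zero energy forces equal values across each positive conductance, in particular across each
  transition of \<open>P\<close>; irreducibility propagates this to all pairs.\<close>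

lemma energy_zero_imp_const:
  assumes "energy f f = 0"
  shows "f x = f y"
proof -
  have "(\<Sum>x\<in>UNIV. \<Sum>y\<in>UNIV. conductance x y * ((f x - f y) * (f x - f y))) = 0"
    using assms by (simp add: energy_def)
  then have z: "conductance x y * ((f x - f y) * (f x - f y)) = 0" for x y
    by (simp add: sum_nonneg_eq_0_iff sum_nonneg conductance_nonneg)
  have step: "f x = f y" if "0 < P $ x $ y" for x y
  proof -
    have "0 < \<pi> $ x * P $ x $ y" "0 \<le> \<pi> $ y * P $ y $ x" using that pi_pos[of x] pi_pos[of y] P_nonneg by auto
    then have "0 < conductance x y" by (simp add: conductance_eq)
    with z[of x y] show ?thesis by simp
  qed
  have "f x = f y" if "0 < matrix_power P n $ x $ y" for n x
    using that
  proof (induction n arbitrary: x)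
    case 0
    then show ?case by (simp add: matrix_power_0 mat_def split: if_splits)
  next
    case (Suc n)
    have "0 < (\<Sum>z\<in>UNIV. P $ x $ z * matrix_power P n $ z $ y)"
      using Suc.prems by (simp add: matrix_power_Suc matrix_matrix_mult_def)
    then obtain z where "0 < P $ x $ z * matrix_power P n $ z $ y"
      by (meson not_less sum_nonpos)
    then have "0 < P $ x $ z" "0 < matrix_power P n $ z $ y"
      using P_nonneg[of x z] by (auto simp: zero_less_mult_iff)
    then show ?case using step Suc.IH by metis
  qed
  then show ?thesis using irred unfolding irreducible_matrix_def by metis
qed

subsection \<open>Variational description of the eigenvalues\<close>

lemma energy_axis: "energy (($) f) (($) (axis x 1)) = \<pi> $ x * ((mat 1 - Q) *v f) $ x"
  and inner_pi_axis: "inner_pi g (($) (axis x 1)) = \<pi> $ x * g x"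
proof -
  have "(\<Sum>z\<in>UNIV. \<pi> $ z * (axis x 1 :: real^'a) $ z * h z) = (\<Sum>z\<in>UNIV. if z = x then \<pi> $ z * h z else 0)" for h
    by (intro sum.cong) (auto simp: axis_def)
  then have *: "(\<Sum>z\<in>UNIV. \<pi> $ z * (axis x 1 :: real^'a) $ z * h z) = \<pi> $ x * h x" for h
    by simp
  show "energy (($) f) (($) (axis x 1)) = \<pi> $ x * ((mat 1 - Q) *v f) $ x"
    by (simp only: generator_weak_form[symmetric] *)
  show "inner_pi g (($) (axis x 1)) = \<pi> $ x * g x"
    using *[of g] by (simp add: inner_pi_def mult_ac)
qed

text \<open>The eigenvalues of the restricted matrix are the critical values of the Rayleigh quotient on
  functions supported in \<open>A\<close>; testing against point masses in \<open>A\<close> recovers the matrix equation.\<close>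

lemma lambda_set_minimizer:
  assumes "A \<noteq> {}"
  obtains f where "\<exists>x. f x \<noteq> 0" "\<And>x. x \<notin> A \<Longrightarrow> f x = 0"
    "energy f f = lambda_set P \<pi> A * inner_pi f f"
    "\<And>g. (\<And>x. x \<notin> A \<Longrightarrow> g x = 0) \<Longrightarrow> lambda_set P \<pi> A * inner_pi g g \<le> energy g g"
proof -
  let ?V = "{f :: real^'a. \<forall>x. x \<notin> A \<longrightarrow> f $ x = 0}"
  obtain a where "a \<in> A" using assms by blast
  then have "axis a (1::real) \<in> ?V" "axis a (1::real) \<noteq> (0::real^'a)" by (auto simp: axis_def vec_eq_iff)
  moreover have "subspace ?V" by (simp add: subspace_def)
  moreover have "0 < inner_pi (($) f) (($) f)" if "f \<noteq> 0" for f :: "real^'a"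
    using that inner_pi_pos by (auto simp: vec_eq_iff)
  ultimately obtain f \<mu> where f: "f \<in> ?V" "f \<noteq> 0"
      "\<And>g. g \<in> ?V \<Longrightarrow> energy (($) f) (($) g) = \<mu> * inner_pi (($) f) (($) g)"
      "\<And>g. g \<in> ?V \<Longrightarrow> \<mu> * inner_pi (($) g) (($) g) \<le> energy (($) g) (($) g)"
    using rayleigh_minimizer[OF bilinear_energy energy_sym bilinear_inner_pi inner_pi_sym, of ?V "axis a 1"]
    by blast
  have restrict: "(\<Sum>y\<in>A. (mat 1 - Q) $ x $ y * g $ y) = ((mat 1 - Q) *v g) $ x" if "g \<in> ?V" for x g
    unfolding matrix_vector_mult_def using that by (auto intro: sum.mono_neutral_left)
  have "lambda_set P \<pi> A = \<mu>"
    unfolding lambda_set_def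
  proof (rule Least_equality)
    have "((mat 1 - Q) *v f) $ x = \<mu> * f $ x" if "x \<in> A" for x
    proof -
      have "axis x 1 \<in> ?V" using that by (auto simp: axis_def)
      from f(3)[OF this] show ?thesis using pi_pos[of x] by (simp add: energy_axis inner_pi_axis)
    qed
    moreover have "\<exists>x\<in>A. f $ x \<noteq> 0" using f(1,2) by (auto simp: vec_eq_iff)
    ultimately show "eigenvalue_on A (mat 1 - Q) \<mu>"
      unfolding eigenvalue_on_def using restrict[OF f(1)] by (intro exI[of _ f]) simp
  next
    fix \<nu> assume "eigenvalue_on A (mat 1 - Q) \<nu>"
    then obtain h where h: "\<exists>x\<in>A. h $ x \<noteq> 0" "\<And>x. x \<in> A \<Longrightarrow> (\<Sum>y\<in>A. (mat 1 - Q) $ x $ y * h $ y) = \<nu> * h $ x"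
      unfolding eigenvalue_on_def by blast
    define k :: "real^'a" where "k = (\<chi> x. if x \<in> A then h $ x else 0)"
    have k: "k \<in> ?V" by (simp add: k_def)
    have ev: "((mat 1 - Q) *v k) $ x = \<nu> * k $ x" if "x \<in> A" for x
      using restrict[OF k, of x] h(2)[OF that] that by (simp add: k_def)
    have "energy (($) k) (($) k) = (\<Sum>x\<in>UNIV. \<pi> $ x * k $ x * ((mat 1 - Q) *v k) $ x)"
      by (simp add: generator_weak_form)
    also have "\<dots> = (\<Sum>x\<in>UNIV. \<nu> * (\<pi> $ x * k $ x * k $ x))"
      using ev k by (intro sum.cong refl) (force simp: mult_ac)
    also have "\<dots> = \<nu> * inner_pi (($) k) (($) k)" by (simp add: inner_pi_def sum_distrib_left)
    finally have "\<mu> * inner_pi (($) k) (($) k) \<le> \<nu> * inner_pi (($) k) (($) k)" using f(4)[OF k] by simp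
    moreover obtain x where "x \<in> A" "h $ x \<noteq> 0" using h(1) by blast
    moreover from this have "k $ x \<noteq> 0" by (simp add: k_def)
    ultimately show "\<mu> \<le> \<nu>" using inner_pi_pos[of "($) k" x] by simp
  qed
  moreover have "lambda_set P \<pi> A * inner_pi g g \<le> energy g g" if "\<And>x. x \<notin> A \<Longrightarrow> g x = 0" for g
  proof -
    have "(\<chi> x. g x) \<in> ?V" using that by simp
    from f(4)[OF this] show ?thesis by (simp add: calculation vec_nth_vec_lambda)
  qed
  moreover have "energy (($) f) (($) f) = \<mu> * inner_pi (($) f) (($) f)" using f(1,3) by blast
  ultimately show ?thesis using that[of "($) f"] f(1,2) by (auto simp: vec_eq_iff)
qed

text \<open>The minimizer is taken among mean-zero functions.  Its weak equation extends to all test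
  functions, as both forms vanish against constants; and an eigenfunction of a nonzero
  eigenvalue has mean zero, so no such eigenvalue lies below the minimum.\<close>

lemma spectral_gap_minimizer:
  obtains f where "\<exists>x. f x \<noteq> 0" "inner_pi f (\<lambda>x. 1) = 0"
    "\<And>g. energy f g = spectral_gap P \<pi> * inner_pi f g" "0 < spectral_gap P \<pi>"
    "\<And>g. inner_pi g (\<lambda>x. 1) = 0 \<Longrightarrow> spectral_gap P \<pi> * inner_pi g g \<le> energy g g"
proof -
  let ?one = "\<lambda>x::'a. 1::real"
  let ?V = "{f :: real^'a. inner_pi (($) f) ?one = 0}"
  have e1: "energy f ?one = 0" for f by (simp add: energy_def)
  obtain a b :: 'a where ab: "a \<noteq> b"
    using two_states card_2_iff' ex_card[of 2 "UNIV::'a set"] by metis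
  \<comment> \<open>a nonzero mean-zero function\<close>
  let ?v = "(\<chi> x. if x = a then \<pi> $ b else if x = b then - \<pi> $ a else 0) :: real^'a"
  have "inner_pi (($) ?v) ?one = (\<Sum>x\<in>{a, b}. \<pi> $ x * ?v $ x)"
    unfolding inner_pi_def by (rule sum.mono_neutral_cong_right) auto
  also have "\<dots> = 0" using ab by simp
  finally have "?v \<in> ?V" by simp
  moreover have "?v \<noteq> 0" using pi_pos[of b] by (auto simp: vec_eq_iff intro!: exI[of _ a])
  moreover have "subspace ?V"
    by (auto simp: subspace_def inner_pi_def distrib_left distrib_right sum.distrib sum_distrib_left[symmetric] mult.left_commute)
  moreover have pos: "0 < inner_pi (($) f) (($) f)" if "f \<noteq> 0" for f :: "real^'a"
    using that inner_pi_pos by (auto simp: vec_eq_iff)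
  ultimately obtain f \<mu> where f: "f \<in> ?V" "f \<noteq> 0"
      "\<And>g. g \<in> ?V \<Longrightarrow> energy (($) f) (($) g) = \<mu> * inner_pi (($) f) (($) g)"
      "\<And>g. g \<in> ?V \<Longrightarrow> \<mu> * inner_pi (($) g) (($) g) \<le> energy (($) g) (($) g)"
    using rayleigh_minimizer[OF bilinear_energy energy_sym bilinear_inner_pi inner_pi_sym, of ?V ?v]
    by blast
  have weak: "energy (($) f) g = \<mu> * inner_pi (($) f) g" for g
  proof -
    define m where "m = inner_pi g ?one"
    have "inner_pi (\<lambda>x. g x - m) ?one = 0"
      by (simp add: m_def inner_pi_def right_diff_distrib sum_subtractf sum_distrib_right[symmetric] pi_sum)
    then have "(\<chi> x. g x - m) \<in> ?V" by (simp add: vec_nth_vec_lambda)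
    from f(3)[OF this] have "energy (($) f) (\<lambda>x. g x - m) = \<mu> * inner_pi (($) f) (\<lambda>x. g x - m)"
      by (simp add: vec_nth_vec_lambda)
    moreover have "energy (($) f) (\<lambda>x. g x - m) = energy (($) f) g" by (simp add: energy_def)
    moreover have "inner_pi (($) f) (\<lambda>x. g x - m) = inner_pi (($) f) g - m * inner_pi (($) f) ?one"
      by (simp add: inner_pi_def right_diff_distrib sum_subtractf sum_distrib_left mult_ac)
    ultimately show ?thesis using f(1) by simp
  qed
  have "\<mu> \<noteq> 0"
  proof
    assume "\<mu> = 0"
    then have const: "f $ x = f $ y" for x y
      using energy_zero_imp_const[of "($) f"] weak[of "($) f"] by simp
    have "inner_pi (($) f) ?one = (\<Sum>x\<in>UNIV. \<pi> $ x * f $ a)"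
      unfolding inner_pi_def using const by (intro sum.cong) auto
    also have "\<dots> = f $ a" by (simp add: sum_distrib_right[symmetric] pi_sum)
    finally have "f $ a = 0" using f(1) by simp
    then have "f = 0" using const by (metis vec_eq_iff zero_index)
    with f(2) show False by simp
  qed
  have "\<mu> * inner_pi (($) f) (($) f) \<ge> 0" using weak[of "($) f"] energy_nonneg[of "($) f"] by simp
  then have "0 < \<mu>" using pos[OF f(2)] \<open>\<mu> \<noteq> 0\<close> by (simp add: zero_le_mult_iff)
  have "spectral_gap P \<pi> = \<mu>"
    unfolding spectral_gap_def
  proof (rule Least_equality, rule conjI[OF \<open>\<mu> \<noteq> 0\<close>])
    have "((mat 1 - Q) *v f) $ x = \<mu> * f $ x" for x
      using weak[of "($) (axis x 1)"] pi_pos[of x] by (simp add: energy_axis inner_pi_axis)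
    then show "eigenvalue_on UNIV (mat 1 - Q) \<mu>"
      unfolding eigenvalue_on_def using f(2)
      by (intro exI[of _ f]) (auto simp: vec_eq_iff matrix_vector_mult_def)
  next
    fix \<nu> assume "\<nu> \<noteq> 0 \<and> eigenvalue_on UNIV (mat 1 - Q) \<nu>"
    then obtain h :: "real^'a" where nu: "\<nu> \<noteq> 0" and h: "\<exists>x. h $ x \<noteq> 0" "\<And>x. ((mat 1 - Q) *v h) $ x = \<nu> * h $ x"
      unfolding eigenvalue_on_def matrix_vector_mult_def by auto
    have ev: "energy (($) h) g = \<nu> * inner_pi (($) h) g" for g
    proof -
      have "energy (($) h) g = (\<Sum>x\<in>UNIV. \<pi> $ x * g x * ((mat 1 - Q) *v h) $ x)"
        by (simp add: generator_weak_form)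
      also have "\<dots> = \<nu> * inner_pi (($) h) g"
        by (simp add: h(2) inner_pi_def sum_distrib_left mult_ac)
      finally show ?thesis .
    qed
    have "h \<in> ?V" using ev[of ?one] nu by (simp add: e1)
    from f(4)[OF this] have "\<mu> * inner_pi (($) h) (($) h) \<le> \<nu> * inner_pi (($) h) (($) h)" by (simp add: ev)
    then show "\<mu> \<le> \<nu>" using h(1) inner_pi_pos[of "($) h"] by auto
  qed
  moreover have "\<mu> * inner_pi g g \<le> energy g g" if "inner_pi g ?one = 0" for g
    using f(4)[of "\<chi> x. g x"] that by (simp add: vec_nth_vec_lambda)
  ultimately show ?thesis using that[of "($) f"] f(1,2) weak \<open>0 < \<mu>\<close> by (auto simp: vec_eq_iff)
qed

lemma spectral_gap_pos: "0 < spectral_gap P \<pi>"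
  by (rule spectral_gap_minimizer)

lemma poincare:
  assumes "inner_pi g (\<lambda>x. 1) = 0"
  shows "inner_pi g g \<le> t_rel P \<pi> * energy g g"
proof -
  have "spectral_gap P \<pi> * inner_pi g g \<le> energy g g"
    by (rule spectral_gap_minimizer) (use assms in blast)
  then show ?thesis using spectral_gap_pos by (simp add: t_rel_def pos_le_divide_eq mult.commute)
qed

section \<open>The Faber-Krahn inequality\<close>

abbreviation mu :: "'a set \<Rightarrow> real" where "mu \<equiv> measure_of_set \<pi>"

lemma mu_pos: "A \<noteq> {} \<Longrightarrow> 0 < mu A"
  unfolding measure_of_set_def using pi_pos by (intro sum_pos) auto

lemma mu_mono: "A \<subseteq> B \<Longrightarrow> mu A \<le> mu B"
  unfolding measure_of_set_def using pi_pos by (intro sum_mono2) (auto simp: less_imp_le)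

lemma mu_UNIV: "mu UNIV = 1"
  by (simp add: measure_of_set_def pi_sum)

lemma mu_Un_disjoint: "A \<inter> B = {} \<Longrightarrow> mu (A \<union> B) = mu A + mu B"
  unfolding measure_of_set_def by (rule sum.union_disjoint) auto

lemma con_half_iff: "A \<in> con_half P \<pi> \<longleftrightarrow> connected_set Q A \<and> mu A \<le> 1 / 2"
  by (simp add: con_half_def)

text \<open>Singletons cannot be split, and of two distinct states one has mass at most \<open>1/2\<close>.\<close>

lemma con_half_nonempty: "con_half P \<pi> \<noteq> {}"
proof -
  have connected: "connected_set Q {a}" for a
    using connected_or_split[OF transition_matrix_Q, of "{a}"] by blast
  obtain a b :: 'a where "a \<noteq> b"
    using two_states card_2_iff' ex_card[of 2 "UNIV::'a set"] by metis
  then have "mu {a} + mu {b} \<le> 1"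
    using mu_Un_disjoint[of "{a}" "{b}"] mu_mono[of "{a, b}" UNIV] mu_UNIV
    by (simp add: insert_commute)
  then have "{a} \<in> con_half P \<pi> \<or> {b} \<in> con_half P \<pi>"
    using connected by (auto simp: con_half_iff)
  then show ?thesis by blast
qed

lemma abs_ln_mu: "A \<noteq> {} \<Longrightarrow> \<bar>ln (mu A)\<bar> = - ln (mu A)"
  using mu_pos[of A] mu_mono[of A UNIV] by (simp add: mu_UNIV)

lemma abs_ln_mu_ge:
  assumes "A \<noteq> {}" "mu A \<le> c"
  shows "- ln c \<le> \<bar>ln (mu A)\<bar>"
proof -
  have "ln (mu A) \<le> ln c" using mu_pos[OF assms(1)] assms(2) by (intro ln_mono) auto
  then show ?thesis by (simp add: abs_ln_mu[OF assms(1)])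
qed

lemma abs_ln_mu_ge_ln_2:
  assumes "A \<noteq> {}" "mu A \<le> 1 / 2"
  shows "ln 2 \<le> \<bar>ln (mu A)\<bar>"
  using abs_ln_mu_ge[OF assms] by (simp add: ln_div)

lemma lambda_set_le_energy:
  assumes "A \<noteq> {}" "\<And>x. x \<notin> A \<Longrightarrow> h x = 0"
  shows "lambda_set P \<pi> A * inner_pi h h \<le> energy h h"
  by (rule lambda_set_minimizer[OF assms(1)]) (use assms(2) in blast)

lemma lambda_set_pos:
  assumes "A \<noteq> {}" "A \<noteq> UNIV"
  shows "0 < lambda_set P \<pi> A"
proof -
  obtain f where f: "\<exists>x. f x \<noteq> 0" "\<And>x. x \<notin> A \<Longrightarrow> f x = 0"
    "energy f f = lambda_set P \<pi> A * inner_pi f f"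
    by (rule lambda_set_minimizer[OF assms(1)]) (rule that)
  obtain x y where "f x \<noteq> 0" "y \<notin> A" using f(1) assms(2) by blast
  then have "energy f f \<noteq> 0" using energy_zero_imp_const[of f x y] f(2)[of y] by auto
  then have "0 < energy f f" using energy_nonneg[of f] by (simp add: less_le)
  then have "0 < lambda_set P \<pi> A * inner_pi f f" using f(3) by simp
  then show ?thesis using inner_pi_nonneg[of f] by (simp add: zero_less_mult_iff)
qed

lemma half_imp_ne_UNIV: "mu A \<le> 1 / 2 \<Longrightarrow> A \<noteq> UNIV"
  using mu_UNIV by auto

lemma alpha_attained: obtains A where "A \<in> con_half P \<pi>" "alpha P \<pi> = alpha_set P \<pi> A"
proof -
  have "Min (alpha_set P \<pi> ` con_half P \<pi>) \<in> alpha_set P \<pi> ` con_half P \<pi>"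
    using con_half_nonempty by (intro Min_in) auto
  then show ?thesis using that by (auto simp: alpha_def)
qed

lemma alpha_pos: "0 < alpha P \<pi>"
proof -
  obtain A where A: "A \<in> con_half P \<pi>" "alpha P \<pi> = alpha_set P \<pi> A" by (rule alpha_attained)
  then have "A \<noteq> {}" "mu A \<le> 1 / 2" by (auto simp: con_half_iff connected_set_def)
  then have "0 < \<bar>ln (mu A)\<bar>" "0 < lambda_set P \<pi> A"
    using abs_ln_mu_ge_ln_2[of A] ln_gt_zero[of 2] lambda_set_pos[of A] half_imp_ne_UNIV[of A] by auto
  then show ?thesis unfolding A(2) alpha_set_def by (rule divide_pos_pos[rotated])
qed

lemma alpha_le_lambda_set:
  assumes "A \<in> con_half P \<pi>"
  shows "alpha P \<pi> * \<bar>ln (mu A)\<bar> \<le> lambda_set P \<pi> A"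
proof -
  have "A \<noteq> {}" "mu A \<le> 1 / 2" using assms by (auto simp: con_half_iff connected_set_def)
  then have "0 < \<bar>ln (mu A)\<bar>" using abs_ln_mu_ge_ln_2[of A] ln_gt_zero[of 2] by linarith
  moreover have "alpha P \<pi> \<le> alpha_set P \<pi> A"
    unfolding alpha_def using assms by (intro Min_le) auto
  ultimately show ?thesis by (simp add: alpha_set_def pos_le_divide_eq)
qed

lemma energy_add: "energy (\<lambda>x. f x + g x) (\<lambda>x. f x + g x) = energy f f + 2 * energy f g + energy g g"
proof -
  have "conductance x y * ((f x + g x - (f y + g y)) * (f x + g x - (f y + g y)))
      = conductance x y * ((f x - f y) * (f x - f y)) + 2 * (conductance x y * ((f x - f y) * (g x - g y)))
        + conductance x y * ((g x - g y) * (g x - g y))" for x y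
    by (simp add: algebra_simps)
  note * = this
  show ?thesis
    unfolding energy_def * sum.distrib sum_distrib_left[symmetric] by (simp add: add_divide_distrib)
qed

text \<open>For connected \<open>A\<close> this is the definition of \<open>\<alpha>\<close>.  Otherwise \<open>A\<close> splits into two parts without
  conductance between them; energy and norm are additive over the parts, and
  \<open>|ln \<pi>|\<close> only grows when passing to a part.\<close>

lemma faber_krahn:
  assumes "A \<noteq> {}" "mu A \<le> 1 / 2" "\<And>x. x \<notin> A \<Longrightarrow> h x = 0"
  shows "alpha P \<pi> * \<bar>ln (mu A)\<bar> * inner_pi h h \<le> energy h h"
  using finite[of A] assms
proof (induction A arbitrary: h rule: finite_psubset_induct)
  case (psubset A)
  show ?case
  proof (cases "connected_set Q A")
    case True
    then have A: "A \<in> con_half P \<pi>" using psubset.prems by (simp add: con_half_iff)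
    have "alpha P \<pi> * \<bar>ln (mu A)\<bar> * inner_pi h h \<le> lambda_set P \<pi> A * inner_pi h h"
      using alpha_le_lambda_set[OF A] inner_pi_nonneg by (rule mult_right_mono)
    also have "\<dots> \<le> energy h h" using psubset.prems(1,3) by (rule lambda_set_le_energy)
    finally show ?thesis .
  next
    case False
    then obtain B where B: "B \<noteq> {}" "B \<subset> A" "\<And>x y. x \<in> B \<Longrightarrow> y \<in> A - B \<Longrightarrow> Q $ x $ y = 0"
      using connected_or_split[OF transition_matrix_Q psubset.prems(1)] by metis
    define h1 h2 where "h1 x = (if x \<in> B then h x else 0)" and "h2 x = (if x \<in> B then 0 else h x)" for x
    have h: "h = (\<lambda>x. h1 x + h2 x)" by (auto simp: h1_def h2_def)
    have cross: "h1 x * h2 x = 0" "conductance x y * (h1 x * h2 y) = 0" for x y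
      using B(3)[of x y] psubset.prems(3)[of y] by (auto simp: h1_def h2_def conductance_def)
    have "energy h1 h2 = 0" by (simp add: energy_expand inner_pi_def cross mult.assoc)
    then have energy: "energy h h = energy h1 h1 + energy h2 h2" by (simp add: h energy_add)
    have "inner_pi h h = inner_pi h1 h1 + inner_pi h2 h2"
      unfolding inner_pi_def sum.distrib[symmetric] by (intro sum.cong) (auto simp: h1_def h2_def)
    moreover have sub: "alpha P \<pi> * \<bar>ln (mu A)\<bar> * inner_pi k k \<le> energy k k"
      if C: "C \<noteq> {}" "C \<subset> A" and k: "\<And>x. x \<notin> C \<Longrightarrow> k x = 0" for C k
    proof -
      have le: "mu C \<le> mu A" using C by (intro mu_mono) auto
      have "alpha P \<pi> * \<bar>ln (mu A)\<bar> * inner_pi k k \<le> alpha P \<pi> * \<bar>ln (mu C)\<bar> * inner_pi k k"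
        using abs_ln_mu_ge[OF C(1) le] alpha_pos inner_pi_nonneg[of k] psubset.prems(1)
        by (intro mult_right_mono mult_left_mono) (auto simp: abs_ln_mu)
      also have "\<dots> \<le> energy k k" using C k le psubset.prems(2) by (intro psubset.IH) auto
      finally show ?thesis .
    qed
    moreover have "alpha P \<pi> * \<bar>ln (mu A)\<bar> * inner_pi h1 h1 \<le> energy h1 h1"
      using B by (intro sub[of B]) (auto simp: h1_def)
    moreover have "alpha P \<pi> * \<bar>ln (mu A)\<bar> * inner_pi h2 h2 \<le> energy h2 h2"
      using B psubset.prems(3) by (intro sub[of "A - B"]) (auto simp: h2_def)
    ultimately show ?thesis by (simp add: energy distrib_left)
  qed
qed

text \<open>For an eigenfunction \<open>f\<close> with positive part \<open>p\<close>, cutting off decreases the energy in the sense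
  \<open>energy p p \<le> energy f p = \<lambda> \<parallel>p\<parallel>\<^sup>2\<close>; now apply Faber-Krahn to \<open>p\<close>.  Both \<open>f\<close> and \<open>-f\<close> have a
  nonzero positive part, and one of the two supports has mass at most \<open>1/2\<close>.\<close>

lemma alpha_ln_2_le_spectral_gap: "alpha P \<pi> * ln 2 \<le> spectral_gap P \<pi>"
proof -
  have main: "alpha P \<pi> * ln 2 \<le> spectral_gap P \<pi>"
    if f: "\<And>g. energy f g = spectral_gap P \<pi> * inner_pi f g"
      and pos: "0 < f a" and half: "mu {x. 0 < f x} \<le> 1 / 2" for f a
  proof -
    define p where "p x = max (f x) 0" for x
    have A: "{x. 0 < f x} \<noteq> {}" using pos by blast
    have "alpha P \<pi> * ln 2 * inner_pi p p \<le> alpha P \<pi> * \<bar>ln (mu {x. 0 < f x})\<bar> * inner_pi p p"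
      using abs_ln_mu_ge_ln_2[OF A half] alpha_pos inner_pi_nonneg
      by (intro mult_right_mono mult_left_mono) auto
    also have "\<dots> \<le> energy p p" using A half by (intro faber_krahn) (auto simp: p_def)
    also have "\<dots> \<le> energy f p"
      unfolding energy_def
    proof (intro divide_right_mono sum_mono mult_left_mono conductance_nonneg)
      show "(p x - p y) * (p x - p y) \<le> (f x - f y) * (p x - p y)" for x y
      proof (cases "f x \<le> f y")
        case True
        then show ?thesis by (intro mult_right_mono_neg) (auto simp: p_def)
      next
        case False
        then show ?thesis by (intro mult_right_mono) (auto simp: p_def)
      qed
    qed simp
    also have "\<dots> = spectral_gap P \<pi> * inner_pi p p"
    proof -
      have "inner_pi f p = inner_pi p p"
        unfolding inner_pi_def by (intro sum.cong) (auto simp: p_def max_def)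
      then show ?thesis by (simp add: f)
    qed
    finally show ?thesis using inner_pi_pos[of p a] pos by (simp add: p_def)
  qed
  obtain f where f: "\<exists>x. f x \<noteq> 0" "inner_pi f (\<lambda>x. 1) = 0"
    "\<And>g. energy f g = spectral_gap P \<pi> * inner_pi f g"
    by (rule spectral_gap_minimizer) (rule that)
  have f': "energy (\<lambda>x. - f x) g = spectral_gap P \<pi> * inner_pi (\<lambda>x. - f x) g" for g
  proof -
    have "energy (\<lambda>x. - f x) g = - energy f g"
      by (simp add: energy_def sum_negf[symmetric] minus_divide_left algebra_simps)
    also have "\<dots> = spectral_gap P \<pi> * inner_pi (\<lambda>x. - f x) g"
      by (simp add: f(3) inner_pi_def sum_negf)
    finally show ?thesis .
  qed
  have sum0: "(\<Sum>x\<in>UNIV. \<pi> $ x * f x) = 0" using f(2) by (simp add: inner_pi_def)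
  have "\<exists>a. 0 < f a"
  proof (rule ccontr)
    assume "\<not> ?thesis"
    then have "\<forall>x. \<pi> $ x * - f x = 0"
      using sum_nonneg_eq_0_iff[of UNIV "\<lambda>x. \<pi> $ x * - f x"] sum0 pi_pos
      by (simp add: sum_negf not_less mult_nonneg_nonpos less_imp_le)
    then show False using f(1) pi_pos by (metis less_irrefl mult_eq_0_iff neg_equal_0_iff_equal)
  qed
  moreover have "\<exists>b. 0 < - f b"
  proof (rule ccontr)
    assume "\<not> ?thesis"
    then have "\<forall>x. \<pi> $ x * f x = 0"
      using sum_nonneg_eq_0_iff[of UNIV "\<lambda>x. \<pi> $ x * f x"] sum0 pi_pos
      by (simp add: not_less less_imp_le)
    then show False using f(1) pi_pos by (metis less_irrefl mult_eq_0_iff)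
  qed
  moreover have "mu {x. 0 < f x} + mu {x. 0 < - f x} \<le> 1"
    using mu_Un_disjoint[of "{x. 0 < f x}" "{x. 0 < - f x}"] mu_mono[OF subset_UNIV] mu_UNIV
    by (metis (no_types, lifting) disjoint_iff mem_Collect_eq neg_0_less_iff_less order_less_asym)
  then have "mu {x. 0 < f x} \<le> 1 / 2 \<or> mu {x. 0 < - f x} \<le> 1 / 2" by linarith
  ultimately show ?thesis using main[of f, OF f(3)] main[of "\<lambda>x. - f x", OF f'] by blast
qed

section \<open>Entropy\<close>

text \<open>Jensen's inequality for \<open>u ln u\<close> on \<open>A\<close>, through its tangent at the conditional mean
  \<open>c = F / \<pi>(A)\<close> of \<open>f\<^sup>2\<close>.\<close>

lemma entropy_ge_of_support:
  assumes A: "A \<noteq> {}" and f: "\<And>x. x \<notin> A \<Longrightarrow> f x = 0"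
  shows "inner_pi f f * \<bar>ln (mu A)\<bar> \<le> entropy_of \<pi> (\<lambda>x. (f x)\<^sup>2)"
proof -
  define F where "F = inner_pi f f"
  have F: "F = (\<Sum>x\<in>UNIV. \<pi> $ x * (f x)\<^sup>2)" by (simp add: F_def inner_pi_def power2_eq_square mult.assoc)
  have FA: "F = (\<Sum>x\<in>A. \<pi> $ x * (f x)\<^sup>2)"
    unfolding F using f by (intro sum.mono_neutral_right) auto
  have ent: "entropy_of \<pi> (\<lambda>x. (f x)\<^sup>2) = (\<Sum>x\<in>UNIV. \<pi> $ x * ((f x)\<^sup>2 * ln ((f x)\<^sup>2))) - F * ln F"
    by (simp add: entropy_of_def expect_def F)
  show ?thesis
  proof (cases "F = 0")
    case True
    then have "f x = 0" for x using inner_pi_pos[of f x] by (auto simp: F_def)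
    then show ?thesis by (simp add: entropy_of_def expect_def inner_pi_def)
  next
    case False
    then have F0: "0 < F" using inner_pi_nonneg[of f] by (simp add: F_def)
    define c where "c = F / mu A"
    have c: "0 < c" using F0 mu_pos[OF A] by (simp add: c_def)
    have tangent: "u * ln c + u - c \<le> u * ln u" if "0 \<le> u" for u
    proof (cases "u = 0")
      case False
      then have "ln (c / u) \<le> c / u - 1" using that c by (intro ln_le_minus_one) auto
      then have "u * ln (c / u) \<le> u * (c / u - 1)" using that by (rule mult_left_mono)
      then show ?thesis using False that c by (simp add: ln_div algebra_simps)
    qed (use c in simp)
    have "F * ln F + F * \<bar>ln (mu A)\<bar> = F * ln c"
      using F0 mu_pos[OF A] by (simp add: abs_ln_mu[OF A] c_def ln_div algebra_simps)
    also have "\<dots> = F * ln c + F - mu A * c" using mu_pos[OF A] by (simp add: c_def)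
    also have "\<dots> = (\<Sum>x\<in>A. \<pi> $ x * ((f x)\<^sup>2 * ln c + (f x)\<^sup>2 - c))"
      unfolding FA measure_of_set_def
      by (simp add: algebra_simps sum.distrib sum_subtractf sum_distrib_right sum_distrib_left)
    also have "\<dots> \<le> (\<Sum>x\<in>A. \<pi> $ x * ((f x)\<^sup>2 * ln ((f x)\<^sup>2)))"
      using pi_pos by (intro sum_mono mult_left_mono tangent) (auto simp: less_imp_le)
    also have "\<dots> = (\<Sum>x\<in>UNIV. \<pi> $ x * ((f x)\<^sup>2 * ln ((f x)\<^sup>2)))"
      using f by (intro sum.mono_neutral_left) auto
    finally show ?thesis by (simp add: ent F_def[symmetric])
  qed
qed

lemma entropy_nonneg: "0 \<le> entropy_of \<pi> (\<lambda>x. (f x)\<^sup>2)"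
  using entropy_ge_of_support[of UNIV f] by (simp add: mu_UNIV)

lemma entropy_of_mult:
  assumes "0 < c" "\<And>x. 0 \<le> h x"
  shows "entropy_of \<pi> (\<lambda>x. c * h x) = c * entropy_of \<pi> h"
proof -
  have *: "c * u * ln (c * u) = c * (u * ln u) + c * ln c * u" if "0 \<le> u" for u
    using that assms(1) by (cases "u = 0") (simp_all add: ln_mult algebra_simps)
  have "0 \<le> expect \<pi> h" unfolding expect_def using assms(2) pi_pos by (intro sum_nonneg) (simp add: less_imp_le)
  moreover have "expect \<pi> (\<lambda>x. c * h x) = c * expect \<pi> h"
    by (simp add: expect_def sum_distrib_left mult_ac)
  moreover have "expect \<pi> (\<lambda>x. c * h x * ln (c * h x)) = c * expect \<pi> (\<lambda>x. h x * ln (h x)) + c * ln c * expect \<pi> h"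
    unfolding *[OF assms(2)] by (simp add: expect_def sum_distrib_left distrib_left sum.distrib mult_ac)
  ultimately show ?thesis
    using *[of "expect \<pi> h"] by (simp add: entropy_of_def right_diff_distrib)
qed

section \<open>The log-Sobolev inequality\<close>

lemma energy_mult: "energy (\<lambda>x. c * f x) (\<lambda>x. c * f x) = c\<^sup>2 * energy f f"
  by (simp add: energy_def right_diff_distrib[symmetric] sum_distrib_left power2_eq_square mult_ac)

lemma energy_abs_le: "energy (\<lambda>x. \<bar>f x\<bar>) (\<lambda>x. \<bar>f x\<bar>) \<le> energy f f"
  unfolding energy_def
proof (intro divide_right_mono sum_mono mult_left_mono conductance_nonneg)
  show "(\<bar>f x\<bar> - \<bar>f y\<bar>) * (\<bar>f x\<bar> - \<bar>f y\<bar>) \<le> (f x - f y) * (f x - f y)" for x y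
    using abs_le_square_iff[of "\<bar>f x\<bar> - \<bar>f y\<bar>" "f x - f y"] by (simp add: power2_eq_square abs_triangle_ineq3)
qed simp

lemma sum_energy_slice_le: "(\<Sum>k\<le>N. energy (\<lambda>x. slice k (f x)) (\<lambda>x. slice k (f x))) \<le> 2 * energy f f"
proof -
  have "(\<Sum>k\<le>N. energy (\<lambda>x. slice k (f x)) (\<lambda>x. slice k (f x)))
     = (\<Sum>x\<in>UNIV. \<Sum>y\<in>UNIV. conductance x y * (\<Sum>k\<le>N. (slice k (f x) - slice k (f y))\<^sup>2)) / 2"
    unfolding energy_def sum_divide_distrib[symmetric] power2_eq_square sum_distrib_left
    by (subst sum.swap, subst (2) sum.swap) simp
  also have "\<dots> \<le> (\<Sum>x\<in>UNIV. \<Sum>y\<in>UNIV. conductance x y * (2 * (f x - f y)\<^sup>2)) / 2"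
    by (intro divide_right_mono sum_mono mult_left_mono conductance_nonneg sum_slice_diff_squared_le) simp
  also have "\<dots> = 2 * energy f f"
    by (simp add: energy_def power2_eq_square sum_distrib_left mult_ac)
  finally show ?thesis .
qed

text \<open>By Markov's inequality the support \<open>{f > 3\<^bsup>k\<^esup>}\<close> has mass at most \<open>9\<^bsup>-k\<^esup>\<close>, which is below \<open>1/2\<close> as
  soon as \<open>k \<ge> 1\<close>; for \<open>k = 0\<close> the weight vanishes.\<close>

lemma faber_krahn_slice:
  assumes f: "\<And>x. 0 \<le> f x" "inner_pi f f = 1"
  shows "alpha P \<pi> * (real k * ln 9) * inner_pi (\<lambda>x. slice k (f x)) (\<lambda>x. slice k (f x))
     \<le> energy (\<lambda>x. slice k (f x)) (\<lambda>x. slice k (f x))" (is "_ * inner_pi ?h ?h \<le> _")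
proof (cases "k = 0 \<or> {x. 3 ^ k < f x} = {}")
  case True
  then have "k = 0 \<or> (\<forall>x. ?h x = 0)" by (auto intro: slice_eq_0 simp: not_less)
  then have "real k * inner_pi ?h ?h = 0" by (auto simp: inner_pi_def)
  then show ?thesis using energy_nonneg[of ?h] by auto
next
  case False
  define A where "A = {x. 3 ^ k < f x}"
  have A: "A \<noteq> {}" "1 \<le> k" using False by (auto simp: A_def)
  have "mu A * 9 ^ k = (\<Sum>x\<in>A. \<pi> $ x * (3 ^ k)\<^sup>2)"
    by (simp add: measure_of_set_def sum_distrib_right power_mult[symmetric] mult.commute[of k] flip: power_mult) (simp add: power_mult)
  also have "\<dots> \<le> (\<Sum>x\<in>A. \<pi> $ x * (f x)\<^sup>2)"
    using pi_pos by (intro sum_mono mult_left_mono power_mono) (auto simp: A_def less_imp_le)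
  also have "\<dots> \<le> (\<Sum>x\<in>UNIV. \<pi> $ x * (f x)\<^sup>2)"
    using pi_pos by (intro sum_mono2) (auto simp: less_imp_le)
  also have "\<dots> = 1" using f(2) by (simp add: inner_pi_def power2_eq_square mult.assoc)
  finally have muA: "mu A \<le> 1 / 9 ^ k" by (simp add: field_simps)
  have "(9::real) ^ 1 \<le> 9 ^ k" using A(2) by (intro power_increasing) auto
  then have "1 / (9::real) ^ k \<le> 1 / 2" by (intro divide_left_mono) auto
  with muA have half: "mu A \<le> 1 / 2" by linarith
  have "real k * ln 9 \<le> \<bar>ln (mu A)\<bar>"
    using abs_ln_mu_ge[OF A(1) muA] by (simp add: ln_div ln_realpow)
  then have "alpha P \<pi> * (real k * ln 9) * inner_pi ?h ?h \<le> alpha P \<pi> * \<bar>ln (mu A)\<bar> * inner_pi ?h ?h"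
    using alpha_pos inner_pi_nonneg[of ?h] by (intro mult_right_mono mult_left_mono) auto
  also have "\<dots> \<le> energy ?h ?h"
    using A(1) half by (rule faber_krahn) (auto simp: A_def not_less intro: slice_eq_0)
  finally show ?thesis .
qed

text \<open>Integrate the pointwise bound against \<open>\<pi>\<close>, with \<open>m\<close> the mean of \<open>f\<close>: the linear term vanishes, the
  quadratic one becomes a variance, and the slices are controlled by Faber-Krahn.\<close>

lemma log_sobolev_normalized:
  assumes f: "\<And>x. 0 \<le> f x" "inner_pi f f = 1"
  shows "entropy_of \<pi> (\<lambda>x. (f x)\<^sup>2) \<le> 2 * (kappa P \<pi> + t_rel P \<pi> * (1 + ln 49)) * energy f f"
proof -
  define m where "m = inner_pi f (\<lambda>x. 1)"
  define g where "g x = f x - m" for x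
  have m': "m = (\<Sum>x\<in>UNIV. \<pi> $ x * f x)" by (simp add: m_def inner_pi_def)
  have g0: "(\<Sum>x\<in>UNIV. \<pi> $ x * g x) = 0"
    by (simp add: g_def right_diff_distrib sum_subtractf sum_distrib_right[symmetric] pi_sum m')
  have "inner_pi g g = (\<Sum>x\<in>UNIV. \<pi> $ x * f x * f x) - 2 * m * (\<Sum>x\<in>UNIV. \<pi> $ x * f x) + m\<^sup>2 * (\<Sum>x\<in>UNIV. \<pi> $ x)"
    by (simp add: inner_pi_def g_def power2_eq_square algebra_simps sum.distrib sum_subtractf sum_distrib_left)
  also have "\<dots> = 1 - m\<^sup>2" using f(2) by (simp add: m'[symmetric] pi_sum inner_pi_def power2_eq_square)
  finally have "m\<^sup>2 \<le> 1" using inner_pi_nonneg[of g] by simp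
  then have m1: "m \<le> 1" by (simp add: abs_square_le_1 abs_le_iff)
  obtain x0 where "f x0 \<noteq> 0" using f(2) by (fastforce simp: inner_pi_def)
  then have "0 < \<pi> $ x0 * f x0" using f(1)[of x0] pi_pos[of x0] by (simp add: less_le)
  also have "\<dots> \<le> m" unfolding m' using f(1) pi_pos by (intro member_le_sum) (auto simp: less_imp_le)
  finally have m0: "0 < m" .
  have "1 < (3::real)" by simp
  then obtain N where "Max (range f) < 3 ^ N" using real_arch_pow by blast
  then have N: "f x < 3 ^ (N + 1)" for x
  proof -
    have "f x \<le> Max (range f)" by simp
    also note \<open>Max (range f) < 3 ^ N\<close>
    also have "(3::real) ^ N \<le> 3 ^ (N + 1)" by (rule power_increasing) auto
    finally show ?thesis .
  qed
  let ?h = "\<lambda>k x. slice k (f x)" and ?C = "2 * (1 + ln (49::real))"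
  have "entropy_of \<pi> (\<lambda>x. (f x)\<^sup>2) = (\<Sum>x\<in>UNIV. \<pi> $ x * ((f x)\<^sup>2 * ln ((f x)\<^sup>2)))"
    using f(2) by (simp add: entropy_of_def expect_def inner_pi_def power2_eq_square mult.assoc)
  also have "\<dots> \<le> (\<Sum>x\<in>UNIV. \<pi> $ x * ((2 * m * ln (m\<^sup>2) + 2 * m) * g x + ?C * (g x)\<^sup>2
      + (\<Sum>k\<le>N. real k * ln 9 * (?h k x)\<^sup>2)))"
    using pi_pos entropy_pointwise_bound[OF m0 m1 f(1) N]
    by (intro sum_mono mult_left_mono) (auto simp: g_def less_imp_le)
  also have "\<dots> = (2 * m * ln (m\<^sup>2) + 2 * m) * (\<Sum>x\<in>UNIV. \<pi> $ x * g x) + ?C * inner_pi g g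
      + (\<Sum>k\<le>N. real k * ln 9 * inner_pi (?h k) (?h k))"
  proof -
    have "(\<Sum>x\<in>UNIV. \<pi> $ x * (\<Sum>k\<le>N. real k * ln 9 * (?h k x)\<^sup>2)) = (\<Sum>k\<le>N. real k * ln 9 * inner_pi (?h k) (?h k))"
      unfolding inner_pi_def sum_distrib_left by (subst sum.swap) (simp add: power2_eq_square mult_ac)
    moreover have "(\<Sum>x\<in>UNIV. \<pi> $ x * (a * g x)) = a * (\<Sum>x\<in>UNIV. \<pi> $ x * g x)" for a
      by (simp add: sum_distrib_left mult_ac)
    moreover have "(\<Sum>x\<in>UNIV. \<pi> $ x * (a * (g x)\<^sup>2)) = a * inner_pi g g" for a
      by (simp add: inner_pi_def sum_distrib_left power2_eq_square mult_ac)
    ultimately show ?thesis by (simp only: distrib_left[of "\<pi> $ _"] sum.distrib)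
  qed
  also have "\<dots> \<le> ?C * (t_rel P \<pi> * energy f f) + kappa P \<pi> * (2 * energy f f)"
  proof -
    have "inner_pi g g \<le> t_rel P \<pi> * energy g g" using g0 by (intro poincare) (simp add: inner_pi_def)
    also have "energy g g = energy f f" by (simp add: energy_def g_def)
    finally have "?C * inner_pi g g \<le> ?C * (t_rel P \<pi> * energy f f)" by (rule mult_left_mono) simp
    moreover have "(\<Sum>k\<le>N. real k * ln 9 * inner_pi (?h k) (?h k)) \<le> kappa P \<pi> * (2 * energy f f)"
    proof -
      have "(\<Sum>k\<le>N. real k * ln 9 * inner_pi (?h k) (?h k)) \<le> (\<Sum>k\<le>N. kappa P \<pi> * energy (?h k) (?h k))"
        using faber_krahn_slice[OF f] alpha_pos by (intro sum_mono) (simp add: kappa_def field_simps)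
      also have "\<dots> = kappa P \<pi> * (\<Sum>k\<le>N. energy (?h k) (?h k))" by (simp add: sum_distrib_left)
      also have "\<dots> \<le> kappa P \<pi> * (2 * energy f f)"
        using alpha_pos sum_energy_slice_le by (intro mult_left_mono) (auto simp: kappa_def)
      finally show ?thesis .
    qed
    ultimately show ?thesis by (simp add: g0)
  qed
  finally show ?thesis by (simp add: algebra_simps)
qed

text \<open>Passing to \<open>|f|\<close> keeps the entropy and does not increase the energy, and both are homogeneous of
  degree two.\<close>

lemma log_sobolev:
  "entropy_of \<pi> (\<lambda>x. (f x)\<^sup>2) \<le> 2 * (kappa P \<pi> + t_rel P \<pi> * (1 + ln 49)) * energy f f"
    (is "_ \<le> ?K * _")
proof (cases "inner_pi f f = 0")
  case True
  then have f0: "f x = 0" for x using inner_pi_pos[of f x] by auto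
  show ?thesis by (simp add: f0 entropy_of_def expect_def energy_def)
next
  case False
  define F where "F = inner_pi f f"
  have F: "0 < F" using False inner_pi_nonneg[of f] by (simp add: F_def)
  define g where "g x = 1 / sqrt F * \<bar>f x\<bar>" for x
  have "inner_pi g g = 1 / F * inner_pi f f"
    unfolding inner_pi_def sum_distrib_left
    using F by (intro sum.cong) (simp_all add: g_def mult_ac flip: abs_mult)
  then have "inner_pi g g = 1" using F by (simp add: F_def)
  then have g: "entropy_of \<pi> (\<lambda>x. (g x)\<^sup>2) \<le> ?K * energy g g"
    by (rule log_sobolev_normalized[rotated]) (use F in \<open>simp add: g_def\<close>)
  have "(\<lambda>x. (f x)\<^sup>2) = (\<lambda>x. F * (g x)\<^sup>2)" using F by (simp add: g_def power_mult_distrib power_divide)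
  then have "entropy_of \<pi> (\<lambda>x. (f x)\<^sup>2) = F * entropy_of \<pi> (\<lambda>x. (g x)\<^sup>2)" using F by (simp add: entropy_of_mult)
  also have "\<dots> \<le> F * (?K * energy g g)" using g F by (intro mult_left_mono) auto
  also have "energy g g = 1 / F * energy (\<lambda>x. \<bar>f x\<bar>) (\<lambda>x. \<bar>f x\<bar>)"
    unfolding g_def energy_mult using F by (simp add: power_divide)
  also have "F * (?K * \<dots>) = ?K * energy (\<lambda>x. \<bar>f x\<bar>) (\<lambda>x. \<bar>f x\<bar>)" using F by simp
  also have "\<dots> \<le> ?K * energy f f"
    using alpha_pos spectral_gap_pos by (intro mult_left_mono energy_abs_le) (simp add: kappa_def t_rel_def)
  finally show ?thesis .
qed

end

section \<open>The comparison of the time scales\<close>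

theorem theorem1p2:
  fixes P :: "real^'a^'a" and \<pi> :: "real^'a"
  assumes "2 \<le> CARD('a)"
    and "transition_matrix P"
    and "irreducible_matrix P"
    and "stationary_distribution P \<pi>"
  shows "ereal (kappa P \<pi>) \<le> t_LS P \<pi>
    \<and> t_LS P \<pi> \<le> ereal (2 * (kappa P \<pi> + t_rel P \<pi> * (1 + ln 49)))
    \<and> 2 * (kappa P \<pi> + t_rel P \<pi> * (1 + ln 49)) \<le> 2 * (1 + (1 + ln 49) / ln 2) * kappa P \<pi>
    \<and> 2 * (1 + (1 + ln 49) / ln 2) * kappa P \<pi> < 17 * kappa P \<pi>"
proof -
  interpret irreducible_chain P \<pi> using assms by unfold_locales
  let ?K = "2 * (kappa P \<pi> + t_rel P \<pi> * (1 + ln 49))"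
  have kappa: "0 < kappa P \<pi>" using alpha_pos by (simp add: kappa_def)
  have rel: "0 < t_rel P \<pi>" using spectral_gap_pos by (simp add: t_rel_def)
  have K: "0 < ?K" using kappa rel by (simp add: add_pos_pos)
  have lower: "ereal (1 / ?K) \<le> c_LS P \<pi>"
    unfolding c_LS_def
  proof (rule INF_greatest)
    fix f :: "real^'a"
    let ?d = "entropy_of \<pi> (\<lambda>x. (f $ x)\<^sup>2)"
    show "ereal (1 / ?K) \<le> log_sobolev_ratio P \<pi> f"
    proof (cases "?d = 0")
      case False
      then have "0 < ?d" using entropy_nonneg[of "($) f"] by simp
      with log_sobolev[of "($) f"] K have "1 / ?K \<le> dirichlet P \<pi> f / ?d"
        by (simp add: dirichlet_eq_energy field_simps)
      with False show ?thesis by (simp add: log_sobolev_ratio_def)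
    qed (simp add: log_sobolev_ratio_def)
  qed
  have upper: "c_LS P \<pi> \<le> ereal (alpha P \<pi>)"
  proof -
    obtain A where A: "A \<in> con_half P \<pi>" "alpha P \<pi> = alpha_set P \<pi> A" by (rule alpha_attained)
    then have A': "A \<noteq> {}" "mu A \<le> 1 / 2" by (auto simp: con_half_iff connected_set_def)
    obtain f where f: "\<exists>x. f x \<noteq> 0" "\<And>x. x \<notin> A \<Longrightarrow> f x = 0"
      "energy f f = lambda_set P \<pi> A * inner_pi f f"
      by (rule lambda_set_minimizer[OF A'(1)]) (rule that)
    define v :: "real^'a" where "v = (\<chi> x. f x)"
    have v: "($) v = f" by (simp add: v_def vec_nth_vec_lambda)
    obtain x y where "f x \<noteq> 0" "y \<notin> A" using f(1) half_imp_ne_UNIV[OF A'(2)] by blast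
    then have "v $ x \<noteq> v $ y" using f(2)[of y] by (simp add: v)
    then have "\<exists>x y. v $ x \<noteq> v $ y" by blast
    then have "c_LS P \<pi> \<le> log_sobolev_ratio P \<pi> v" unfolding c_LS_def by (intro INF_lower) simp
    also have "\<dots> \<le> ereal (alpha P \<pi>)"
    proof -
      have F: "0 < inner_pi f f" using \<open>f x \<noteq> 0\<close> by (rule inner_pi_pos)
      have L: "0 < \<bar>ln (mu A)\<bar>" using abs_ln_mu_ge_ln_2[OF A'] ln_gt_zero[of 2] by linarith
      let ?d = "entropy_of \<pi> (\<lambda>x. (f x)\<^sup>2)"
      have d: "inner_pi f f * \<bar>ln (mu A)\<bar> \<le> ?d" using A'(1) f(2) by (rule entropy_ge_of_support)
      have pos: "0 < inner_pi f f * \<bar>ln (mu A)\<bar>" using F L by (rule mult_pos_pos)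
      have "energy f f / ?d \<le> energy f f / (inner_pi f f * \<bar>ln (mu A)\<bar>)"
        using d pos energy_nonneg by (intro divide_left_mono) auto
      also have "\<dots> = alpha P \<pi>" using F by (simp add: f(3) A(2) alpha_set_def)
      finally show ?thesis using d pos by (simp add: log_sobolev_ratio_def dirichlet_eq_energy v)
    qed
    finally show ?thesis .
  qed
  obtain c where c: "c_LS P \<pi> = ereal c" using lower upper by (cases "c_LS P \<pi>") auto
  have c1: "1 / ?K \<le> c" and c2: "c \<le> alpha P \<pi>" using lower upper by (simp_all add: c)
  have c0: "0 < c" using c1 K by (smt (verit) divide_pos_pos)
  have tLS: "t_LS P \<pi> = ereal (1 / c)" using c0 by (simp add: t_LS_def c one_ereal_def)
  have "kappa P \<pi> \<le> 1 / c" using c0 c2 by (simp add: kappa_def frac_le)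
  moreover have "1 / c \<le> ?K" using c0 c1 K by (simp add: field_simps)
  moreover have "?K \<le> 2 * (1 + (1 + ln 49) / ln 2) * kappa P \<pi>"
  proof -
    have "t_rel P \<pi> \<le> kappa P \<pi> / ln 2"
      using alpha_ln_2_le_spectral_gap alpha_pos spectral_gap_pos by (simp add: t_rel_def kappa_def frac_le)
    then have "t_rel P \<pi> * (1 + ln 49) \<le> kappa P \<pi> / ln 2 * (1 + ln 49)" by (rule mult_right_mono) simp
    then have "?K \<le> 2 * (kappa P \<pi> + kappa P \<pi> / ln 2 * (1 + ln 49))" by simp
    also have "\<dots> = 2 * (1 + (1 + ln 49) / ln 2) * kappa P \<pi>" by (simp add: algebra_simps add_divide_distrib)
    finally show ?thesis .
  qed
  moreover have "2 * (1 + (1 + ln 49) / ln 2) * kappa P \<pi> < 17 * kappa P \<pi>"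
    using kappa_coefficient_less_17 kappa by (rule mult_strict_right_mono)
  ultimately show ?thesis by (simp add: tLS)
qed

end
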